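(* Let $\rho\in\mathbb{C}$ with $|\rho|<1$, $x\in\mathbb{R}$, and let $a,b,c\in\mathbb{C}$ be such that $\Re a>0$, $\Re b>0$, $\Re c>0$ and $\Im a=\Im b=\Im c$. Then $$ (1-\rho)^{1-2\Re a-2\Re b}\ {}_3F_2\!\left(\begin{matrix}\Re a+\Re b-\tfrac12,\ \Re a+\Re b,\ a+ix\\ 2\Re a,\ a+\overline{b}\end{matrix};-\frac{4\rho}{(1-\rho)^2}\right) $$ $$ =\sum_{k=0}^\infty \frac{(2\Re a+2\Re b-1)_{2k}}{(2\Re a)_k\,(\Re a+\Re b)_k\,(2\Re a+2\Re c+k-1)_k}\ {}_2F_1\!\left(\begin{matrix}\Re a+\Re b+k-\tfrac12,\ \Re b-\Re c\\ \Re a+\Re c+k+\tfrac12\end{matrix};\rho^2\right)(-i\rho)^k\,p_k(x;a,c,\overline{a},\overline{c}). $$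
   Context: The Pochhammer symbol is $(z)_n=\prod_{i=1}^n(z+i-1)$ (so $(z)_0=1$). The generalized hypergeometric function is ${}_pF_q(a_1,\dots,a_p;b_1,\dots,b_q;z)=\sum_{n\ge0}\frac{(a_1)_n\cdots(a_p)_n}{(b_1)_n\cdots(b_q)_n}\frac{z^n}{n!}$; for $p=q+1$ it is continued analytically from $|z|<1$ to $\mathbb{C}\setminus[1,\infty)$. The map $\rho\mapsto-4\rho/(1-\rho)^2$ sends the unit disk bijectively onto $\mathbb{C}\setminus[1,\infty)$, so the left-hand side is well defined. Powers of $1-\rho$ are taken with the principal branch. The continuous Hahn polynomials with two pairs of conjugate parameters are, for $a,b\in\mathbb{C}$ with positive real parts, $$p_n(x;a,b,\overline{a},\overline{b})=i^n\frac{(2\Re a)_n(a+\overline{b})_n}{n!}\ {}_3F_2\!\left(\begin{matrix}-n,\ n+2\Re a+2\Re b-1,\ a+ix\\ 2\Re a,\ a+\overline{b}\end{matrix};1\right).$$ *)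

theory Defs
  imports "HOL-Complex_Analysis.Complex_Analysis"
begin

definition cut_plane :: "complex set" where
  "cut_plane = - (complex_of_real ` {1..})"

text \<open>
  The generalized hypergeometric function, as the sum of the power series
  \<^const>\<open>fps_hypergeo\<close> with the lists of upper and lower parameters.
  If there is one upper parameter more than there are lower ones, it is continued from the unit disk
  to the cut plane. The values on the cut remain those of the series; in particular, a
  terminating series can be evaluated at 1. Outside the domain of definition (divergent series)
  the value is unspecified.
\<close>

definition hypergeo :: "complex list \<Rightarrow> complex list \<Rightarrow> complex \<Rightarrow> complex" where
  "hypergeo as bs z =
     (if length as = length bs + 1 \<and> z \<in> cut_plane \<and> 1 \<le> norm z
      then (THE w. \<exists>f. f holomorphic_on cut_plane \<and>
                       (\<forall>u\<in>ball 0 1. f u = eval_fps (fps_hypergeo as bs 1) u) \<and> w = f z)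
      else eval_fps (fps_hypergeo as bs 1) z)"

lemma eval_fps_hypergeo:
  fixes z :: complex
  shows "eval_fps (fps_hypergeo as bs 1) z =
    (\<Sum>n. prod_list (map (\<lambda>a. pochhammer a n) as) / prod_list (map (\<lambda>b. pochhammer b n) bs)
           * (z ^ n / fact n))"
proof -
  have "foldl (\<lambda>r a. r * f a) u as = u * prod_list (map f as)" for f and u :: complex and as :: "complex list"
    by (induction as arbitrary: u) (simp_all add: mult.assoc)
  then show ?thesis
    by (simp add: eval_fps_def)
qed

lemma open_cut_plane: "open cut_plane"
  unfolding cut_plane_def
  by (intro open_Compl closed_injective_linear_image) 
     (auto simp: linear_of_real inj_of_real)

lemma ball_subset_cut_plane: "ball 0 1 \<subseteq> cut_plane"
  by (auto simp: cut_plane_def)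

lemma starlike_cut_plane: "starlike cut_plane"
  unfolding starlike_def
proof (intro bexI ballI subsetI)
  show "0 \<in> cut_plane" by (auto simp: cut_plane_def)
next
  fix z w assume z: "z \<in> cut_plane" and "w \<in> closed_segment 0 z"
  then obtain t where t: "0 \<le> t" "t \<le> 1" "w = of_real t * z"
    by (auto simp: in_segment scaleR_conv_of_real)
  show "w \<in> cut_plane"
  proof (rule ccontr)
    assume "w \<notin> cut_plane"
    then obtain s where s: "1 \<le> s" "w = complex_of_real s"
      by (auto simp: cut_plane_def)
    with t have "t > 0" by (cases "t = 0") auto
    then have "z = complex_of_real (s / t)" using s t by (simp add: field_simps)
    moreover have "1 \<le> s / t" using s t \<open>t > 0\<close> by (simp add: field_simps)
    ultimately show False using z unfolding cut_plane_def by (metis ComplD atLeast_iff imageI)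
  qed
qed

lemma hypergeo_eq_continuation:
  assumes "length as = length bs + 1" and "f holomorphic_on cut_plane"
    and "\<And>u. norm u < 1 \<Longrightarrow> f u = eval_fps (fps_hypergeo as bs 1) u"
    and "z \<in> cut_plane"
  shows "hypergeo as bs z = f z"
proof (cases "1 \<le> norm z")
  case True
  have "(THE w. \<exists>g. g holomorphic_on cut_plane \<and>
           (\<forall>u\<in>ball 0 1. g u = eval_fps (fps_hypergeo as bs 1) u) \<and> w = g z) = f z"
  proof (rule the_equality)
    show "\<exists>g. g holomorphic_on cut_plane \<and>
           (\<forall>u\<in>ball 0 1. g u = eval_fps (fps_hypergeo as bs 1) u) \<and> f z = g z"
      using assms by auto
  next
    fix w assume "\<exists>g. g holomorphic_on cut_plane \<and>
           (\<forall>u\<in>ball 0 1. g u = eval_fps (fps_hypergeo as bs 1) u) \<and> w = g z"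
    then obtain g where g: "g holomorphic_on cut_plane"
      "\<And>u. u \<in> ball 0 1 \<Longrightarrow> g u = eval_fps (fps_hypergeo as bs 1) u" "w = g z"
      by blast
    have "g z = f z"
      by (rule analytic_continuation_open[of "ball 0 1" cut_plane g f])
         (use g assms in \<open>auto simp: open_cut_plane ball_subset_cut_plane
            intro!: starlike_imp_connected starlike_cut_plane\<close>)
    with g show "w = f z" by simp
  qed
  with True assms show ?thesis by (simp add: hypergeo_def)
next
  case False
  with assms show ?thesis by (simp add: hypergeo_def)
qed

text \<open>The continuous Hahn polynomial with parameters $a, b, \overline{a}, \overline{b}$.\<close>

definition cont_hahn :: "nat \<Rightarrow> complex \<Rightarrow> complex \<Rightarrow> complex \<Rightarrow> complex" where
  "cont_hahn n x a b =
     \<i> ^ n * (pochhammer (of_real (2 * Re a)) n * pochhammer (a + cnj b) n / fact n) *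
     hypergeo [- of_nat n, of_nat n + of_real (2 * Re a + 2 * Re b - 1), a + \<i> * x]
              [of_real (2 * Re a), a + cnj b] 1"

end

theory Submission
  imports Defs "HOL-Real_Asymp.Real_Asymp"
begin

text \<open>
  Equality of the imaginary parts makes \<open>a + cnj b\<close> real. Put \<open>\<beta> = Re a + Re b\<close>, \<open>\<gamma> = Re a + Re c\<close>
  and let \<open>F N \<beta>\<close> be the terminating sum \<open>3F2(-N, N + 2\<beta> - 1, a + ix; 2 Re a, \<beta>; 1)\<close>.
  Expanding the powers of \<open>1 - \<rho>\<close> for small \<open>\<rho>\<close> turns the left-hand side into the generating function
  of \<open>(2\<beta> - 1)\<^sub>N / N! * F N \<beta>\<close>. The three-term recurrence of \<open>F\<close> shows that \<open>F\<close> grows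
  subexponentially, so the generating function converges on the whole disk; transported by the inverse of
  \<open>\<rho> \<mapsto> -4\<rho> / (1 - \<rho>)\<^sup>2\<close> it provides the analytic continuation of the \<open>3F2\<close>.
  Comparing coefficients of powers of \<open>\<rho>\<close>, the theorem becomes the connection formula between \<open>F N \<beta>\<close>
  and \<open>F (N - 2j) \<gamma>\<close>. Coefficientwise in \<open>(a + ix)\<^sub>n\<close> this is the connection formula for
  Gegenbauer polynomials at the point 1, with parameters \<open>\<beta> - 1/2 + n\<close> and \<open>\<gamma> - 1/2 + n\<close>.
\<close>

section \<open>Connection coefficients of Gegenbauer type\<close>

text \<open>
  For \<open>\<mu> \<noteq> 0\<close> this is \<open>(2\<mu>)\<^sub>k (\<mu> + k) / (\<mu> k!)\<close>, the coefficient in the connection formula for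
  Gegenbauer polynomials; the form below also makes sense at \<open>\<mu> = 0\<close>, which occurs for \<open>\<gamma> = 1/2\<close>.
\<close>
definition gegenbauer_weight :: "real \<Rightarrow> nat \<Rightarrow> real" where
  "gegenbauer_weight \<mu> k =
     pochhammer (2 * \<mu> + 1) (2 * k) / (pochhammer (2 * \<mu> + real k) k * fact k)"

text \<open>The right-hand side of the Gegenbauer connection formula from parameter \<nu> to
  parameter \<mu>, evaluated at 1; its expected value is C_M^\<nu>(1) = (2\<nu>)_M / M!.\<close>

definition gegenbauer_sum :: "real \<Rightarrow> real \<Rightarrow> nat \<Rightarrow> real" where
  "gegenbauer_sum \<mu> \<nu> M =
     (\<Sum>j\<le>M div 2. pochhammer \<nu> (M - j) / pochhammer (\<mu> + 1) (M - j) *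
        (pochhammer (\<nu> - \<mu>) j / fact j) * gegenbauer_weight \<mu> (M - 2 * j))"

lemma pochhammer_real_nonzero: "x > 0 \<Longrightarrow> pochhammer x n \<noteq> (0 :: real)"
  using pochhammer_pos[of x n] by simp

text \<open>For \<open>n = 0\<close> the base \<open>2 * \<mu>\<close> may be zero or negative, but
  then \<open>m = 0\<close> and the product is empty.\<close>

lemma pochhammer_weight_nonzero:
  assumes "\<mu> > - 1 / 2" "m \<le> n"
  shows "pochhammer (2 * \<mu> + real n) m \<noteq> 0"
proof (cases "n = 0")
  case True
  then show ?thesis using assms by auto
next
  case False
  then show ?thesis by (intro pochhammer_real_nonzero) (use assms in linarith)
qed

lemma gegenbauer_weight_0 [simp]: "gegenbauer_weight \<mu> 0 = 1"
  by (simp add: gegenbauer_weight_def)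

text \<open>The familiar form (2\<mu>)_k (\<mu> + k) / (\<mu> k!) at index k + 1, with the first
  factor of (2\<mu>)_(k+1) cancelled against \<mu>. This keeps \<mu> = 0 admissible.\<close>

lemma gegenbauer_weight_Suc:
  assumes "\<mu> > - 1 / 2"
  shows "gegenbauer_weight \<mu> (Suc k) = 2 * pochhammer (2 * \<mu> + 1) k * (\<mu> + real (Suc k)) / fact (Suc k)"
proof -
  have k: "2 * Suc k = k + (Suc k + 1)" by simp
  have *: "pochhammer (2 * \<mu> + 1) (2 * Suc k) =
      pochhammer (2 * \<mu> + 1) k * (pochhammer (2 * \<mu> + real (Suc k)) (Suc k) * (2 * \<mu> + 2 * real (Suc k)))"
    unfolding k pochhammer_product'[of _ k] pochhammer_product'[of _ "Suc k"]
    by (simp add: algebra_simps)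
  show ?thesis
    unfolding gegenbauer_weight_def *
    using pochhammer_weight_nonzero[OF assms, of "Suc k" "Suc k"] by (simp add: field_simps del: fact_Suc pochhammer_Suc)
qed

text \<open>The classical identity (k + \<mu>) C_k^\<mu> = \<mu> (C_k^(\<mu>+1) - C_(k-2)^(\<mu>+1))
  at the point 1; it makes sums of weights telescope.\<close>

lemma gegenbauer_weight_diff:
  assumes "\<mu> > - 1 / 2"
  shows "gegenbauer_weight \<mu> (Suc (Suc k)) =
    pochhammer (2 * \<mu> + 2) (Suc (Suc k)) / fact (Suc (Suc k)) - pochhammer (2 * \<mu> + 2) k / fact k"
proof -
  have "pochhammer (2 * \<mu> + 1) (Suc k) = (2 * \<mu> + 1) * pochhammer (2 * \<mu> + 2) k"
    by (simp add: pochhammer_rec add.assoc)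
  then show ?thesis
    unfolding gegenbauer_weight_Suc[OF assms]
    by (simp add: pochhammer_Suc divide_simps) (simp add: algebra_simps)
qed

text \<open>The same classical identity, now in the parameter \<nu>. It holds term by term once the
  index in the sum for \<open>M\<close> is shifted by one; the term \<open>j = 0\<close> is treated
  separately.\<close>

lemma gegenbauer_sum_step:
  assumes "\<mu> > - 1 / 2" "\<nu> \<noteq> 0"
  shows "gegenbauer_sum \<mu> (\<nu> + 1) (Suc (Suc M)) =
    gegenbauer_sum \<mu> (\<nu> + 1) M + (\<nu> + real (Suc (Suc M))) / \<nu> * gegenbauer_sum \<mu> \<nu> (Suc (Suc M))"
proof -
  define T where "T = (\<lambda>\<nu> M j. pochhammer \<nu> (M - j) / pochhammer (\<mu> + 1) (M - j) *
        (pochhammer (\<nu> - \<mu>) j / fact j) * gegenbauer_weight \<mu> (M - 2 * j))"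
  define N where "N = Suc (Suc M)"
  have R: "gegenbauer_sum \<mu> l m = (\<Sum>j\<le>m div 2. T l m j)" for l m
    by (simp add: gegenbauer_sum_def T_def)
  have N: "gegenbauer_sum \<mu> l N = T l N 0 + (\<Sum>j\<le>M div 2. T l N (Suc j))" for l
    unfolding R N_def by (simp add: sum.atMost_Suc_shift del: sum.atMost_Suc)
  have shift: "\<nu> * pochhammer (\<nu> + 1) n = pochhammer \<nu> n * (\<nu> + real n)" for n
    using pochhammer_rec[of \<nu> n] by (simp add: pochhammer_Suc)
  have 0: "T (\<nu> + 1) N 0 = (\<nu> + real N) / \<nu> * T \<nu> N 0"
  proof -
    have "pochhammer (\<nu> + 1) N = (\<nu> + real N) / \<nu> * pochhammer \<nu> N"
      using shift[of N] assms(2) by (simp add: field_simps)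
    then show ?thesis unfolding T_def by simp
  qed
  have S: "T (\<nu> + 1) N (Suc j) = T (\<nu> + 1) M j + (\<nu> + real N) / \<nu> * T \<nu> N (Suc j)"
    if "j \<le> M div 2" for j
  proof -
    have jM: "j \<le> M" "2 * j \<le> M" using that by auto
    define p where "p = M - j"
    have p: "N - Suc j = Suc p" "N - 2 * Suc j = M - 2 * j" "real N = real p + real j + 2"
      using jM by (auto simp: N_def p_def)
    define L where "L = pochhammer (\<nu> + 1) p"
    define E where "E = pochhammer (\<nu> + 1 - \<mu>) j"
    define U where "U = pochhammer (\<mu> + 1) p"
    define G where "G = gegenbauer_weight \<mu> (M - 2 * j)"
    define X where "X = (fact j :: real)"
    have nz: "U \<noteq> 0" "\<mu> + 1 + real p \<noteq> 0" "X \<noteq> 0" "1 + real j \<noteq> 0"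
      unfolding U_def X_def using assms(1) by (auto intro!: pochhammer_real_nonzero)
    have 1: "T (\<nu> + 1) N (Suc j) = L * (\<nu> + 1 + real p) / (U * (\<mu> + 1 + real p)) *
        (E * (\<nu> + 1 - \<mu> + real j) / ((1 + real j) * X)) * G"
      unfolding T_def p by (simp add: pochhammer_Suc L_def E_def U_def G_def X_def)
    have 2: "T (\<nu> + 1) M j = L / U * (E / X) * G"
      unfolding T_def by (simp add: p_def L_def E_def U_def G_def X_def)
    have e: "\<nu> - \<mu> + 1 = \<nu> + 1 - \<mu>" by simp
    have 3: "T \<nu> N (Suc j) = \<nu> * L / (U * (\<mu> + 1 + real p)) * ((\<nu> - \<mu>) * E / ((1 + real j) * X)) * G"
      unfolding T_def p pochhammer_rec[of \<nu>] pochhammer_rec[of "\<nu> - \<mu>"] e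
      by (simp add: pochhammer_Suc L_def E_def U_def G_def X_def)
    \<comment> \<open>After removal of the common factors the termwise claim is this quadratic
      identity.\<close>
    have "(\<nu> + 1 + real p) * (\<nu> + 1 - \<mu> + real j) =
        (\<mu> + 1 + real p) * (1 + real j) + (\<nu> + real N) * (\<nu> - \<mu>)"
      unfolding p by (simp add: algebra_simps)
    then have "L * E * G * ((\<nu> + 1 + real p) * (\<nu> + 1 - \<mu> + real j)) / (U * X * (\<mu> + 1 + real p) * (1 + real j)) =
        L * E * G * ((\<mu> + 1 + real p) * (1 + real j) + (\<nu> + real N) * (\<nu> - \<mu>)) / (U * X * (\<mu> + 1 + real p) * (1 + real j))"
      by simp
    also have "\<dots> = L * E * G / (U * X) +
        L * E * G * ((\<nu> + real N) * (\<nu> - \<mu>)) / (U * X * (\<mu> + 1 + real p) * (1 + real j))"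
    proof -
      have "K * (V * W + B) / (Y * V * W) = K / Y + K * B / (Y * V * W)"
        if "V \<noteq> 0" "W \<noteq> 0" for K V W B Y :: real
        using that by (simp add: distrib_left add_divide_distrib)
      then show ?thesis using nz by blast
    qed
    finally show ?thesis
      unfolding 1 2 3 using assms(2) by (simp add: mult_ac)
  qed
  have "gegenbauer_sum \<mu> (\<nu> + 1) N = gegenbauer_sum \<mu> (\<nu> + 1) M + (\<nu> + real N) / \<nu> * gegenbauer_sum \<mu> \<nu> N"
    unfolding N R[of _ M] 0 by (simp add: S sum.distrib sum_distrib_left distrib_left)
  then show ?thesis by (simp add: N_def)
qed

text \<open>
  The induction on \<open>\<nu>\<close> starts at \<open>\<mu> + 1\<close> and not at \<open>\<mu>\<close> because the recurrence divides by \<open>\<nu>\<close>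
  and \<open>\<mu>\<close> may vanish.
\<close>
lemma gegenbauer_sum_base:
  assumes "\<mu> > - 1 / 2"
  shows "gegenbauer_sum \<mu> (\<mu> + 1) M = pochhammer (2 * (\<mu> + 1)) M / fact M"
proof -
  \<comment> \<open>At \<nu> = \<mu> + 1 the two Pochhammer quotients are 1, so only the weights
    remain.\<close>
  have *: "gegenbauer_sum \<mu> (\<mu> + 1) m = (\<Sum>j\<le>m div 2. gegenbauer_weight \<mu> (m - 2 * j))" for m
    unfolding gegenbauer_sum_def
    using assms by (intro sum.cong) (auto simp: pochhammer_real_nonzero pochhammer_fact[symmetric])
  show ?thesis
  proof (induction M rule: induct_nat_012)
    case (ge2 n)
    have "gegenbauer_sum \<mu> (\<mu> + 1) (Suc (Suc n)) =
       gegenbauer_weight \<mu> (Suc (Suc n)) + gegenbauer_sum \<mu> (\<mu> + 1) n"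
      unfolding * by (simp add: sum.atMost_Suc_shift del: sum.atMost_Suc)
    then show ?case
      using ge2(1) gegenbauer_weight_diff[OF assms, of n] by simp
  qed (use assms in \<open>simp_all add: * gegenbauer_weight_Suc\<close>)
qed

text \<open>The outer induction raises \<nu> by one through \<open>gegenbauer_sum_step\<close>;
  since that step relates \<open>M + 2\<close> to \<open>M\<close>, the inner induction needs
  \<open>M = 0\<close> and \<open>M = 1\<close> as starting values.\<close>

lemma gegenbauer_sum_shifts:
  assumes "\<mu> > - 1 / 2"
  shows "gegenbauer_sum \<mu> (\<mu> + 1 + real i) M = pochhammer (2 * (\<mu> + 1 + real i)) M / fact M"
proof (induction i arbitrary: M)
  case 0
  then show ?case using gegenbauer_sum_base[OF assms] by simp
next
  case (Suc i)
  define \<nu> where "\<nu> = \<mu> + 1 + real i"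
  have nz: "\<nu> > 0" "\<mu> + 1 > 0" using assms by (auto simp: \<nu>_def)
  have "gegenbauer_sum \<mu> (\<nu> + 1) M = pochhammer (2 * (\<nu> + 1)) M / fact M"
  proof (induction M rule: induct_nat_012)
    case (ge2 n)
    have a: "gegenbauer_sum \<mu> \<nu> m = pochhammer (2 * \<nu>) m / fact m" for m
      using Suc.IH by (simp add: \<nu>_def)
    have b: "pochhammer (2 * \<nu>) (Suc (Suc n)) = 2 * \<nu> * (2 * \<nu> + 1) * pochhammer (2 * (\<nu> + 1)) n"
      by (simp add: pochhammer_rec algebra_simps)
    show ?case
      unfolding gegenbauer_sum_step[OF assms less_imp_neq[OF nz(1), symmetric]] a b ge2
      using nz by (simp add: pochhammer_Suc divide_simps) (simp add: algebra_simps)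
  next
    case 1
    have "gegenbauer_weight \<mu> (Suc 0) = 2 * (\<mu> + 1)"
      unfolding gegenbauer_weight_Suc[OF assms] by simp
    then show ?case using nz by (simp add: gegenbauer_sum_def divide_simps) (simp add: algebra_simps)
  qed (simp add: gegenbauer_sum_def)
  then show ?case by (simp add: \<nu>_def add_ac)
qed

text \<open>For fixed \<open>M\<close> and \<mu> both sides are polynomials in \<nu>, and they agree
  at the infinitely many points \<mu> + 1 + i.\<close>

lemma gegenbauer_sum_eq:
  assumes "\<mu> > - 1 / 2"
  shows "gegenbauer_sum \<mu> \<nu> M = pochhammer (2 * \<nu>) M / fact M"
proof -
  have poch: "poly (pochhammer p n) x = pochhammer (poly p x) n" for p :: "real poly" and n x
    by (simp add: pochhammer_prod poly_prod)
  define p where "p = (\<Sum>j\<le>M div 2. smult (gegenbauer_weight \<mu> (M - 2 * j) / (fact j * pochhammer (\<mu> + 1) (M - j)))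
     (pochhammer [:0, 1:] (M - j) * pochhammer [:-\<mu>, 1:] j))
     - smult (1 / fact M) (pochhammer [:0, 2:] M)"
  have p: "poly p x = gegenbauer_sum \<mu> x M - pochhammer (2 * x) M / fact M" for x
    by (simp add: p_def poly_sum poch gegenbauer_sum_def mult_ac)
  have "range (\<lambda>i. \<mu> + 1 + real i) \<subseteq> {x. poly p x = 0}"
    using gegenbauer_sum_shifts[OF assms] by (auto simp: p)
  moreover have "infinite (range (\<lambda>i. \<mu> + 1 + real i))"
    by (intro range_inj_infinite) (auto intro: injI)
  ultimately have "p = 0"
    using poly_roots_finite finite_subset by blast
  then show ?thesis using p[of \<nu>] by simp
qed

lemma pochhammer_neg_real:
  assumes "n \<le> k"
  shows "pochhammer (- real k) n = (- 1) ^ n * fact k / fact (k - n)"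
proof -
  obtain m where k: "k = m + n" using assms le_Suc_ex add.commute by metis
  have "(fact k :: real) = fact m * pochhammer (1 + real m) n"
    unfolding k pochhammer_fact by (rule pochhammer_product')
  moreover have "pochhammer (- real k) n = (- 1) ^ n * pochhammer (1 + real m) n"
    unfolding pochhammer_minus by (simp add: k add.commute)
  ultimately show ?thesis by (simp add: k)
qed

text \<open>Taking the n-th Taylor coefficient at 1 of a Gegenbauer polynomial lowers the degree by
  n and raises the parameter by n; this is the effect on the weights. The duplication formula splits
  off the first 2n factors of the numerator.\<close>

lemma gegenbauer_weight_shift:
  assumes "\<mu> > - 1 / 2" "n \<le> k"
  shows "gegenbauer_weight \<mu> k * (pochhammer (- real k) n * pochhammer (real k + 2 * \<mu>) n / pochhammer (\<mu> + 1 / 2) n) =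
    (- 4) ^ n * pochhammer (\<mu> + 1) n * gegenbauer_weight (\<mu> + real n) (k - n)"
proof -
  obtain m where k: "k = n + m" using assms(2) le_Suc_ex by blast
  have 1: "pochhammer (2 * \<mu> + 1) (2 * k) =
      4 ^ n * pochhammer (\<mu> + 1 / 2) n * pochhammer (\<mu> + 1) n * pochhammer (2 * (\<mu> + real n) + 1) (2 * m)"
  proof -
    have "pochhammer (2 * \<mu> + 1) (2 * n) = 4 ^ n * pochhammer (\<mu> + 1 / 2) n * pochhammer (\<mu> + 1) n"
      using pochhammer_double[of "\<mu> + 1 / 2" n] by (simp add: power_mult distrib_left add.commute[of 1])
    moreover have "pochhammer (2 * \<mu> + 1) (2 * k) =
        pochhammer (2 * \<mu> + 1) (2 * n) * pochhammer (2 * \<mu> + 1 + real (2 * n)) (2 * m)"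
      unfolding k distrib_left by (rule pochhammer_product')
    moreover have "2 * \<mu> + 1 + real (2 * n) = 2 * (\<mu> + real n) + 1" by simp
    ultimately show ?thesis by (simp only: mult.assoc)
  qed
  have 2: "pochhammer (2 * \<mu> + real k) k = pochhammer (real k + 2 * \<mu>) n * pochhammer (2 * (\<mu> + real n) + real m) m"
    using pochhammer_product'[of "2 * \<mu> + real k" n m] by (simp add: k algebra_simps)
  have 3: "pochhammer (- real k) n = (- 1) ^ n * fact k / fact m"
    using pochhammer_neg_real[OF assms(2)] by (simp add: k)
  have nz: "pochhammer (real k + 2 * \<mu>) n \<noteq> 0" "pochhammer (\<mu> + 1 / 2) n \<noteq> 0"
    using pochhammer_weight_nonzero[OF assms(1), of n k] assms
    by (auto simp: add_ac intro!: pochhammer_real_nonzero)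
  have "(- 4 :: real) ^ n = (- 1) ^ n * 4 ^ n" by (simp flip: power_mult_distrib)
  then show ?thesis
    unfolding gegenbauer_weight_def 1 2 3 using nz by (simp add: k)
qed

section \<open>Terminating hypergeometric sums\<close>

text \<open>The terminating 3F2(-k, k + 2\<gamma> - 1, t; \<alpha>, \<gamma>; 1). In the application
  \<alpha> is 2 Re a, t is a + ix, and the second parameter is Re a + Re b or Re a + Re c.\<close>

definition hahn_sum :: "real \<Rightarrow> real \<Rightarrow> complex \<Rightarrow> nat \<Rightarrow> complex" where
  "hahn_sum \<alpha> \<gamma> t k =
     (\<Sum>n\<le>k. of_real (pochhammer (- real k) n * pochhammer (real k + 2 * \<gamma> - 1) n /
                      (pochhammer \<alpha> n * pochhammer \<gamma> n * fact n)) * pochhammer t n)"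

text \<open>The added terms contain (-k)_n = 0. A common range of summation allows sums of different
  degrees to be compared coefficientwise.\<close>

lemma hahn_sum_extend:
  assumes "k \<le> K"
  shows "hahn_sum \<alpha> \<gamma> t k =
     (\<Sum>n\<le>K. of_real (pochhammer (- real k) n * pochhammer (real k + 2 * \<gamma> - 1) n /
                      (pochhammer \<alpha> n * pochhammer \<gamma> n * fact n)) * pochhammer t n)"
  unfolding hahn_sum_def using assms
  by (intro sum.mono_neutral_left) (auto simp: pochhammer_of_nat_eq_0_iff)

text \<open>Up to normalization, both sides are the n-th derivative of C_N^\<nu> at 1: on the left
  from its 2F1 expansion there, on the right as a multiple of C_(N-n)^(\<nu>+n)(1).\<close>

lemma hahn_sum_coeff:
  assumes "\<nu> > - 1 / 2" "n \<le> N"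
  shows "pochhammer (2 * \<nu>) N / fact N *
      (pochhammer (- real N) n * pochhammer (real N + 2 * \<nu>) n / pochhammer (\<nu> + 1 / 2) n) =
    (- 4) ^ n * pochhammer \<nu> n * (pochhammer (2 * (\<nu> + real n)) (N - n) / fact (N - n))"
proof -
  have "pochhammer (2 * \<nu>) N * pochhammer (real N + 2 * \<nu>) n = pochhammer (2 * \<nu>) (N + n)"
    by (simp add: pochhammer_product' add.commute)
  also have "N + n = 2 * n + (N - n)" using assms(2) by simp
  also have "pochhammer (2 * \<nu>) (2 * n + (N - n)) =
      4 ^ n * pochhammer \<nu> n * pochhammer (\<nu> + 1 / 2) n * pochhammer (2 * (\<nu> + real n)) (N - n)"
    using pochhammer_double[of \<nu> n] by (simp only: pochhammer_product') (simp add: power_mult distrib_left)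
  finally have 1: "pochhammer (2 * \<nu>) N * pochhammer (real N + 2 * \<nu>) n = \<dots>" .
  have nz: "pochhammer (\<nu> + 1 / 2) n \<noteq> 0" using assms(1) by (intro pochhammer_real_nonzero) simp
  have "pochhammer (2 * \<nu>) N / fact N *
      (pochhammer (- real N) n * pochhammer (real N + 2 * \<nu>) n / pochhammer (\<nu> + 1 / 2) n) =
     pochhammer (- real N) n / fact N * (pochhammer (2 * \<nu>) N * pochhammer (real N + 2 * \<nu>) n) / pochhammer (\<nu> + 1 / 2) n"
    by simp
  also have "\<dots> = (- 1) ^ n * 4 ^ n * pochhammer \<nu> n * (pochhammer (2 * (\<nu> + real n)) (N - n) / fact (N - n))"
    unfolding 1 pochhammer_neg_real[OF assms(2)] using nz by simp
  also have "(- 1) ^ n * 4 ^ n = (- 4 :: real) ^ n" by (simp flip: power_mult_distrib)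
  finally show ?thesis .
qed

lemma hahn_connection:
  assumes "\<gamma> > 0" "\<beta> > 0"
  shows "(\<Sum>j\<le>N div 2. of_real (pochhammer (\<beta> - 1 / 2) (N - j) / pochhammer (\<gamma> + 1 / 2) (N - j) *
          (pochhammer (\<beta> - \<gamma>) j / fact j) * gegenbauer_weight (\<gamma> - 1 / 2) (N - 2 * j)) * hahn_sum \<alpha> \<gamma> t (N - 2 * j)) =
         of_real (pochhammer (2 * \<beta> - 1) N / fact N) * hahn_sum \<alpha> \<beta> t N"
proof -
  \<comment> \<open>The shift by 1/2 passes to Gegenbauer parameters.\<close>
  define \<mu> \<nu> where "\<mu> = \<gamma> - 1 / 2" and "\<nu> = \<beta> - 1 / 2"
  have \<mu>: "\<mu> > - 1 / 2" and \<nu>: "\<nu> > - 1 / 2" using assms by (auto simp: \<mu>_def \<nu>_def)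
  have eqs: "\<gamma> = \<mu> + 1 / 2" "\<beta> = \<nu> + 1 / 2" by (auto simp: \<mu>_def \<nu>_def)
  define D where "D = (\<lambda>j. pochhammer \<nu> (N - j) / pochhammer (\<mu> + 1) (N - j) * (pochhammer (\<nu> - \<mu>) j / fact j))"
  define X where "X = (\<lambda>\<mu> k n. pochhammer (- real k) n * pochhammer (real k + 2 * \<mu>) n / pochhammer (\<mu> + 1 / 2) n :: real)"
  \<comment> \<open>\<open>Y n\<close> collects what depends neither on the degree nor on \<beta>
    and \<gamma>, so the coefficients \<open>X\<close> can be compared for each n alone.\<close>
  define Y where "Y = (\<lambda>n. of_real (1 / (pochhammer \<alpha> n * fact n)) * pochhammer t n)"
  have F: "hahn_sum \<alpha> (\<mu> + 1 / 2) t k = (\<Sum>n\<le>N. of_real (X \<mu> k n) * Y n)" if "k \<le> N" for k \<mu>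
    unfolding hahn_sum_extend[OF that] X_def Y_def by (intro sum.cong) (auto simp: mult_ac)
  have key: "(\<Sum>j\<le>N div 2. D j * gegenbauer_weight \<mu> (N - 2 * j) * X \<mu> (N - 2 * j) n) =
      pochhammer (2 * \<nu>) N / fact N * X \<nu> N n" if n: "n \<le> N" for n
  proof -
    define M where "M = N - n"
    have "(\<Sum>j\<le>N div 2. D j * gegenbauer_weight \<mu> (N - 2 * j) * X \<mu> (N - 2 * j) n) =
        (\<Sum>j\<le>M div 2. D j * gegenbauer_weight \<mu> (N - 2 * j) * X \<mu> (N - 2 * j) n)"
    \<comment> \<open>The omitted j have degree \<open>N - 2 * j\<close> below n, where the
      coefficient vanishes.\<close>
    proof (intro sum.mono_neutral_right ballI)
      show "{..M div 2} \<subseteq> {..N div 2}" by (auto simp: M_def)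
      fix j assume "j \<in> {..N div 2} - {..M div 2}"
      then have "n > N - 2 * j" by (auto simp: M_def)
      then have "pochhammer (- real (N - 2 * j)) n = 0" by (simp add: pochhammer_of_nat_eq_0_iff)
      then show "D j * gegenbauer_weight \<mu> (N - 2 * j) * X \<mu> (N - 2 * j) n = 0" by (simp add: X_def)
    qed simp
    also have "\<dots> = (\<Sum>j\<le>M div 2. (- 4) ^ n * pochhammer \<nu> n *
       (pochhammer (\<nu> + real n) (M - j) / pochhammer (\<mu> + real n + 1) (M - j) *
        (pochhammer ((\<nu> + real n) - (\<mu> + real n)) j / fact j) * gegenbauer_weight (\<mu> + real n) (M - 2 * j)))"
    proof (intro sum.cong refl)
      fix j assume "j \<in> {..M div 2}"
      then have j: "N - j = n + (M - j)" "N - 2 * j - n = M - 2 * j" "n \<le> N - 2 * j"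
        using n by (auto simp: M_def)
      have D: "D j = pochhammer \<nu> n * pochhammer (\<nu> + real n) (M - j) /
           (pochhammer (\<mu> + 1) n * pochhammer (\<mu> + real n + 1) (M - j)) * (pochhammer (\<nu> - \<mu>) j / fact j)"
        unfolding D_def j pochhammer_product' by (simp add: add_ac)
      have nz: "pochhammer (\<mu> + 1) n \<noteq> 0" using \<mu> by (intro pochhammer_real_nonzero) simp
      have "gegenbauer_weight \<mu> (N - 2 * j) * X \<mu> (N - 2 * j) n =
          (- 4) ^ n * pochhammer (\<mu> + 1) n * gegenbauer_weight (\<mu> + real n) (M - 2 * j)"
        unfolding X_def using gegenbauer_weight_shift[OF \<mu> j(3)] by (simp only: j(2))
      then show "D j * gegenbauer_weight \<mu> (N - 2 * j) * X \<mu> (N - 2 * j) n = (- 4) ^ n * pochhammer \<nu> n *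
       (pochhammer (\<nu> + real n) (M - j) / pochhammer (\<mu> + real n + 1) (M - j) *
        (pochhammer ((\<nu> + real n) - (\<mu> + real n)) j / fact j) * gegenbauer_weight (\<mu> + real n) (M - 2 * j))"
        unfolding mult.assoc[of "D j"] by (simp add: D nz)
    qed
    also have "\<dots> = (- 4) ^ n * pochhammer \<nu> n * gegenbauer_sum (\<mu> + real n) (\<nu> + real n) M"
      unfolding gegenbauer_sum_def sum_distrib_left ..
    also have "\<dots> = (- 4) ^ n * pochhammer \<nu> n * (pochhammer (2 * (\<nu> + real n)) M / fact M)"
      using \<mu> by (subst gegenbauer_sum_eq) auto
    also have "\<dots> = pochhammer (2 * \<nu>) N / fact N * X \<nu> N n"
      unfolding X_def hahn_sum_coeff[OF \<nu> n] by (simp add: M_def)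
    finally show ?thesis .
  qed
  have "(\<Sum>j\<le>N div 2. of_real (D j * gegenbauer_weight \<mu> (N - 2 * j)) * hahn_sum \<alpha> \<gamma> t (N - 2 * j)) =
     (\<Sum>j\<le>N div 2. \<Sum>n\<le>N. of_real (D j * gegenbauer_weight \<mu> (N - 2 * j) * X \<mu> (N - 2 * j) n) * Y n)"
    unfolding eqs by (intro sum.cong refl) (simp add: F sum_distrib_left mult.assoc)
  also have "\<dots> = (\<Sum>n\<le>N. of_real (\<Sum>j\<le>N div 2. D j * gegenbauer_weight \<mu> (N - 2 * j) * X \<mu> (N - 2 * j) n) * Y n)"
    by (subst sum.swap) (simp add: sum_distrib_right)
  also have "\<dots> = (\<Sum>n\<le>N. of_real (pochhammer (2 * \<nu>) N / fact N * X \<nu> N n) * Y n)"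
    by (intro sum.cong refl) (simp only: key atMost_iff)
  also have "\<dots> = of_real (pochhammer (2 * \<beta> - 1) N / fact N) * hahn_sum \<alpha> \<beta> t N"
    unfolding eqs by (simp add: F sum_distrib_left mult.assoc)
  finally show ?thesis
    by (simp only: D_def \<mu>_def \<nu>_def) (simp add: add.commute algebra_simps)
qed

text \<open>Coefficients of (t)_j are compared; multiplication by t acts through t (t)_j = (t)_(j+1)
  - j (t)_j. The coefficient \<open>P - Q\<close> fits t = 0, where all three sums equal 1.\<close>

lemma hahn_recurrence:
  fixes \<alpha> \<gamma> :: real and n :: nat
  assumes "\<gamma> > 0" "\<alpha> > 0"
  defines "P \<equiv> (real n + 2 * \<gamma>) * (real n + 1 + \<alpha>)"
    and "Q \<equiv> (real n + 1) * (real n + 2 * \<gamma> - \<alpha>)"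
  shows "of_real P * hahn_sum \<alpha> \<gamma> t (n + 2) =
    (of_real (P - Q) - of_real (2 * (2 * real n + 2 * \<gamma> + 1)) * t) * hahn_sum \<alpha> \<gamma> t (n + 1) + of_real Q * hahn_sum \<alpha> \<gamma> t n"
proof -
  define e where "e = (\<lambda>k j. pochhammer (- real k) j * pochhammer (real k + 2 * \<gamma> - 1) j /
                      (pochhammer \<alpha> j * pochhammer \<gamma> j * fact j) :: real)"
  define D where "D = 2 * (2 * real n + 2 * \<gamma> + 1)"
  have F: "hahn_sum \<alpha> \<gamma> t k = (\<Sum>j\<le>n + 2. of_real (e k j) * pochhammer t j)" if "k \<le> n + 2" for k
    unfolding hahn_sum_extend[OF that] e_def ..
  have e0: "e k 0 = 1" for k by (simp add: e_def)
  have eS: "P * e (n + 2) (Suc i) = (P - Q) * e (n + 1) (Suc i) + Q * e n (Suc i)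
      - D * (e (n + 1) i - real (Suc i) * e (n + 1) (Suc i))" for i
  proof -
    \<comment> \<open>In these variables every term becomes a polynomial multiple of the common
      quotient \<open>A * Z / (W * V)\<close>.\<close>
    define k where "k = real n + 1"
    define s where "s = 2 * \<gamma> - 1"
    define A where "A = pochhammer (- k) i"
    define Z where "Z = pochhammer (k + s) i"
    define W where "W = pochhammer \<alpha> i * pochhammer \<gamma> i * fact i"
    define V where "V = (\<alpha> + real i) * (\<gamma> + real i) * (1 + real i)"
    have nz: "W \<noteq> 0" "V \<noteq> 0" "k \<noteq> 0" "k + s \<noteq> 0"
      using assms unfolding W_def V_def k_def s_def by (auto intro!: pochhammer_real_nonzero)
    have den: "pochhammer \<alpha> (Suc i) * pochhammer \<gamma> (Suc i) * fact (Suc i) = W * V"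
      by (simp add: pochhammer_Suc W_def V_def mult_ac)
    have a2: "pochhammer (- real (n + 2)) (Suc i) = - (k + 1) * A"
      by (simp add: pochhammer_rec A_def k_def algebra_simps)
    have a1: "pochhammer (- real (n + 1)) (Suc i) = (- k + real i) * A"
      by (simp add: pochhammer_Suc A_def k_def algebra_simps)
    \<comment> \<open>This symbol is not a polynomial multiple of \<open>A\<close> by itself; the
      factor \<open>k\<close> is supplied by \<open>Q\<close>. In \<open>z2\<close> the factor
      \<open>k + s\<close> is supplied by \<open>P\<close>.\<close>
    have a0: "k * pochhammer (- real n) (Suc i) = - ((- k + real i) * (- k + real i + 1) * A)"
    proof -
      have "- k * pochhammer (- k + 1) (Suc i) = pochhammer (- k) (Suc (Suc i))"
        by (rule pochhammer_rec[symmetric])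
      also have "\<dots> = (- k + real i) * (- k + real i + 1) * A"
        by (simp add: pochhammer_Suc A_def algebra_simps)
      finally have "- k * pochhammer (- k + 1) (Suc i) = (- k + real i) * (- k + real i + 1) * A" .
      moreover have "- k + 1 = - real n" by (simp add: k_def)
      ultimately show ?thesis by (simp only: mult_minus_left minus_equation_iff)
    qed
    have z2: "(k + s) * pochhammer (real (n + 2) + 2 * \<gamma> - 1) (Suc i) = (k + s + real i) * (k + s + real i + 1) * Z"
    proof -
      have "(k + s) * pochhammer (k + s + 1) (Suc i) = pochhammer (k + s) (Suc (Suc i))"
        by (rule pochhammer_rec[symmetric])
      also have "\<dots> = (k + s + real i) * (k + s + real i + 1) * Z"
        by (simp add: pochhammer_Suc Z_def algebra_simps)
      also have "k + s + 1 = real (n + 2) + 2 * \<gamma> - 1" by (simp add: k_def s_def)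
      finally show ?thesis .
    qed
    have z1: "pochhammer (real (n + 1) + 2 * \<gamma> - 1) (Suc i) = (k + s + real i) * Z"
      by (simp add: pochhammer_Suc Z_def k_def s_def algebra_simps)
    have z0: "pochhammer (real n + 2 * \<gamma> - 1) (Suc i) = (k + s - 1) * Z"
      by (simp add: pochhammer_rec Z_def k_def s_def algebra_simps)
    have "P * e (n + 2) (Suc i) = (k + \<alpha>) * pochhammer (- real (n + 2)) (Suc i) *
        ((k + s) * pochhammer (real (n + 2) + 2 * \<gamma> - 1) (Suc i)) / (W * V)"
      unfolding e_def den by (simp add: P_def k_def s_def mult_ac)
    then have 2: "P * e (n + 2) (Suc i) =
        (k + \<alpha>) * (- (k + 1)) * (k + s + real i) * (k + s + real i + 1) * (A * Z / (W * V))"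
      unfolding a2 z2 by simp
    have 1: "e (n + 1) (Suc i) = (- k + real i) * (k + s + real i) * (A * Z / (W * V))"
      unfolding e_def den a1 z1 by simp
    have "Q * e n (Suc i) = (k + s - \<alpha>) * (k * pochhammer (- real n) (Suc i)) *
        pochhammer (real n + 2 * \<gamma> - 1) (Suc i) / (W * V)"
      unfolding e_def den by (simp add: Q_def k_def s_def mult_ac)
    then have 0: "Q * e n (Suc i) =
        (k + s - \<alpha>) * (- ((- k + real i) * (- k + real i + 1))) * (k + s - 1) * (A * Z / (W * V))"
      unfolding a0 z0 by simp
    have m: "e (n + 1) i = V * (A * Z / (W * V))"
      using nz by (simp add: e_def W_def A_def Z_def k_def s_def algebra_simps)
    have PQ: "P = (k + s) * (k + \<alpha>)" "Q = k * (k + s - \<alpha>)" "D = 2 * (2 * k + s)"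
      by (simp_all add: P_def Q_def D_def k_def s_def)
    have g: "\<gamma> = (s + 1) / 2" by (simp add: s_def)
    have "(k + \<alpha>) * (- (k + 1)) * (k + s + real i) * (k + s + real i + 1) =
       (P - Q) * ((- k + real i) * (k + s + real i)) +
       (k + s - \<alpha>) * (- ((- k + real i) * (- k + real i + 1))) * (k + s - 1)
       - D * (V - real (Suc i) * ((- k + real i) * (k + s + real i)))"
      unfolding PQ V_def g by (simp add: field_simps)
    from arg_cong[OF this, of "\<lambda>u. u * (A * Z / (W * V))"] show ?thesis
      unfolding 2 1 0 m by (simp only: distrib_right left_diff_distrib mult.assoc)
  qed
  have shift: "(\<Sum>j\<le>Suc m. (if j = 0 then 0 else of_real (E (j - 1))) * pochhammer t j) =
      (\<Sum>j\<le>m. of_real (E j) * pochhammer t (Suc j))" for E m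
    by (subst sum.atMost_Suc_shift) simp
  \<comment> \<open>The coefficients of \<open>t * hahn_sum \<alpha> \<gamma> t (n + 1)\<close> with
    respect to the (t)_j. By \<open>e1\<close> the index shift does not leave the range up to n +
    2.\<close>
  define G where "G = (\<lambda>j. (if j = 0 then 0 else e (n + 1) (j - 1)) - real j * e (n + 1) j)"
  have e1: "e (n + 1) (n + 2) = 0" by (simp add: e_def pochhammer_of_nat_eq_0_iff flip: of_nat_Suc)
  have tF: "t * hahn_sum \<alpha> \<gamma> t (n + 1) = (\<Sum>j\<le>n + 2. of_real (G j) * pochhammer t j)"
  proof -
    have "t * hahn_sum \<alpha> \<gamma> t (n + 1) = (\<Sum>j\<le>n + 2. of_real (e (n + 1) j) * (t * pochhammer t j))"
      by (simp add: F sum_distrib_left mult_ac del: sum.atMost_Suc)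
    also have "\<dots> = (\<Sum>j\<le>n + 2. of_real (e (n + 1) j) * pochhammer t (Suc j))
       - (\<Sum>j\<le>n + 2. of_real (real j * e (n + 1) j) * pochhammer t j)"
      unfolding sum_subtractf[symmetric] by (intro sum.cong refl) (simp add: pochhammer_Suc algebra_simps)
    also have "(\<Sum>j\<le>n + 2. of_real (e (n + 1) j) * pochhammer t (Suc j)) =
        (\<Sum>j\<le>n + 1. of_real (e (n + 1) j) * pochhammer t (Suc j))"
      using e1 by simp
    also have "\<dots> = (\<Sum>j\<le>n + 2. (if j = 0 then 0 else of_real (e (n + 1) (j - 1))) * pochhammer t j)"
      using shift[of "e (n + 1)" "n + 1"] by simp
    finally have "t * hahn_sum \<alpha> \<gamma> t (n + 1) = \<dots>
       - (\<Sum>j\<le>n + 2. of_real (real j * e (n + 1) j) * pochhammer t j)" .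
    also have "\<dots> = (\<Sum>j\<le>n + 2. of_real (G j) * pochhammer t j)"
      unfolding sum_subtractf[symmetric] G_def
      by (intro sum.cong refl) (simp add: algebra_simps)
    finally show ?thesis .
  qed
  have "P * e (n + 2) j = (P - Q) * e (n + 1) j + Q * e n j - D * G j" for j
    using eS by (cases j) (simp_all add: e0 G_def)
  then have "of_real P * hahn_sum \<alpha> \<gamma> t (n + 2) =
      (\<Sum>j\<le>n + 2. of_real ((P - Q) * e (n + 1) j + Q * e n j - D * G j) * pochhammer t j)"
    by (simp only: F order_refl sum_distrib_left of_real_mult mult.assoc[symmetric] flip: of_real_mult)
  also have "\<dots> = of_real (P - Q) * hahn_sum \<alpha> \<gamma> t (n + 1) + of_real Q * hahn_sum \<alpha> \<gamma> t n
      - of_real D * (t * hahn_sum \<alpha> \<gamma> t (n + 1))"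
    unfolding tF
    unfolding F[of n, OF le_add1] F[of "n + 1", OF add_left_mono[OF one_le_numeral]]
    by (simp add: sum_distrib_left sum.distrib sum_subtractf algebra_simps del: sum.atMost_Suc)
  finally show ?thesis by (simp add: D_def algebra_simps)
qed

section \<open>Subexponential growth and double series\<close>

text \<open>Says that the power series with coefficients \<open>f\<close> has radius of convergence
  at least 1, but as explicit bounds that can serve as majorants of double series.\<close>

definition subexponential :: "(nat \<Rightarrow> 'a :: real_normed_vector) \<Rightarrow> bool" where
  "subexponential f \<longleftrightarrow> (\<forall>q>1. \<exists>K. \<forall>n. norm (f n) \<le> K * q ^ n)"

lemma subexponentialD:
  assumes "subexponential f" "q > 1"
  obtains K where "K \<ge> 0" "\<And>n. norm (f n) \<le> K * q ^ n"
proof -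
  from assms obtain K where K: "\<And>n. norm (f n) \<le> K * q ^ n"
    by (auto simp: subexponential_def)
  with K[of 0] order_trans[OF norm_ge_zero] have "K \<ge> 0" by fastforce
  with K that show ?thesis by blast
qed

lemma subexponential_mult:
  fixes f g :: "nat \<Rightarrow> 'a :: real_normed_algebra"
  assumes "subexponential f" "subexponential g"
  shows "subexponential (\<lambda>n. f n * g n)"
  unfolding subexponential_def
proof (intro allI impI)
  fix q :: real assume "q > 1"
  \<comment> \<open>Each factor gets half of the admissible growth.\<close>
  then have q: "sqrt q > 1" "sqrt q * sqrt q = q" by auto
  obtain K where K: "K \<ge> 0" "\<And>n. norm (f n) \<le> K * sqrt q ^ n" using subexponentialD[OF assms(1) q(1)] by blast
  obtain L where L: "L \<ge> 0" "\<And>n. norm (g n) \<le> L * sqrt q ^ n" using subexponentialD[OF assms(2) q(1)] by blast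
  have "norm (f n * g n) \<le> (K * L) * q ^ n" for n
  proof -
    have "norm (f n * g n) \<le> norm (f n) * norm (g n)" by (rule norm_mult_ineq)
    also have "\<dots> \<le> (K * sqrt q ^ n) * (L * sqrt q ^ n)"
      using K L \<open>q > 1\<close> by (intro mult_mono) auto
    also have "\<dots> = (K * L) * q ^ n"
      by (subst q(2)[symmetric]) (simp only: power_mult_distrib mult_ac)
    finally show ?thesis .
  qed
  then show "\<exists>K. \<forall>n. norm (f n * g n) \<le> K * q ^ n" by blast
qed

lemma subexponential_of_real:
  "subexponential f \<Longrightarrow> subexponential (\<lambda>n. of_real (f n) :: 'a :: real_normed_algebra_1)"
  by (simp add: subexponential_def)

text \<open>Once \<open>r n < q\<close>, a bound for two neighbouring values propagates with one
  factor q per step; the finitely many earlier values are absorbed into the constant.\<close>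

lemma subexponentialI_recurrence:
  assumes "\<And>n. norm (f (Suc (Suc n))) \<le> r n * max (norm (f n)) (norm (f (Suc n)))"
    and "r \<longlonglongrightarrow> 1"
  shows "subexponential f"
  unfolding subexponential_def
proof (intro allI impI)
  fix q :: real assume q: "q > 1"
  with assms(2) have "eventually (\<lambda>n. r n < q) sequentially" by (rule order_tendstoD)
  then obtain N where N: "\<And>n. n \<ge> N \<Longrightarrow> r n < q" by (auto simp: eventually_sequentially)
  define K where "K = Max ((\<lambda>n. norm (f n)) ` {..Suc N})"
  have K: "norm (f n) \<le> K" if "n \<le> Suc N" for n
    unfolding K_def using that by (intro Max_ge) auto
  then have K0: "K \<ge> 0" using order_trans[OF norm_ge_zero] le0 by blast
  have "norm (f n) \<le> K * q ^ n \<and> norm (f (Suc n)) \<le> K * q ^ Suc n" for n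
  proof (induction n)
    case 0
    have "1 * K \<le> q * K" using q K0 by (intro mult_right_mono) auto
    then show ?case using K[of 0] K[of 1] by (simp add: mult.commute)
  next
    case (Suc n)
    show ?case
    proof (cases "n < N")
      case True
      have "norm (f (Suc (Suc n))) \<le> K * 1" using True by (simp add: K)
      also have "\<dots> \<le> K * q ^ Suc (Suc n)"
        using q K0 by (intro mult_left_mono one_le_power) auto
      finally show ?thesis using Suc by simp
    next
      case False
      have "norm (f (Suc (Suc n))) \<le> r n * max (norm (f n)) (norm (f (Suc n)))" by (rule assms(1))
      also have "\<dots> \<le> q * max (norm (f n)) (norm (f (Suc n)))"
        using N[of n] False by (intro mult_right_mono) (auto simp: le_max_iff_disj)
      also have "\<dots> \<le> q * (K * q ^ Suc n)"
      proof (intro mult_left_mono max.boundedI)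
        have "K * q ^ n \<le> K * q ^ Suc n"
          using q K0 by (intro mult_left_mono power_increasing) auto
        then show "norm (f n) \<le> K * q ^ Suc n" using Suc by linarith
      qed (use Suc q in auto)
      finally show ?thesis using Suc by (simp add: mult_ac)
    qed
  qed
  then show "\<exists>K. \<forall>n. norm (f n) \<le> K * q ^ n" by blast
qed

text \<open>The ratio is prescribed only from index 1 on, because
  \<open>gegenbauer_weight_Suc\<close> gives the closed form only there.\<close>

lemma subexponentialI_ratio:
  assumes "\<And>n. norm (f (Suc (Suc n))) \<le> r n * norm (f (Suc n))" and "\<And>n. r n \<ge> 0"
    and "r \<longlonglongrightarrow> 1"
  shows "subexponential f"
  using assms(3)
proof (rule subexponentialI_recurrence[rotated])
  fix n
  have "r n * norm (f (Suc n)) \<le> r n * max (norm (f n)) (norm (f (Suc n)))"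
    by (intro mult_left_mono assms) auto
  with assms(1) show "norm (f (Suc (Suc n))) \<le> r n * max (norm (f n)) (norm (f (Suc n)))"
    by (rule order_trans)
qed

lemma subexponential_pochhammer:
  fixes a :: "'a :: {real_normed_field}" and b :: real
  assumes "b > 0"
  shows "subexponential (\<lambda>n. pochhammer a n / of_real (pochhammer b n))"
proof (rule subexponentialI_ratio)
  fix n
  have "norm (a + of_nat (Suc n)) \<le> norm a + norm (of_nat (Suc n) :: 'a)"
    by (rule norm_triangle_ineq)
  then have "norm (a + of_nat (Suc n)) \<le> norm a + real n + 1"
    unfolding norm_of_nat by simp
  then have "norm (a + of_nat (Suc n)) / \<bar>b + real (Suc n)\<bar> \<le> (norm a + real n + 1) / (b + real n + 1)"
    using assms by (intro frac_le) auto
  then have "norm (a + of_nat (Suc n)) / \<bar>b + real (Suc n)\<bar> * norm (pochhammer a (Suc n) / of_real (pochhammer b (Suc n))) \<le>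
     (norm a + real n + 1) / (b + real n + 1) * norm (pochhammer a (Suc n) / of_real (pochhammer b (Suc n)))"
    by (rule mult_right_mono) simp
  then show "norm (pochhammer a (Suc (Suc n)) / of_real (pochhammer b (Suc (Suc n)))) \<le>
     (norm a + real n + 1) / (b + real n + 1) * norm (pochhammer a (Suc n) / of_real (pochhammer b (Suc n)))"
    unfolding pochhammer_Suc[of _ "Suc n"] of_real_mult norm_divide norm_mult norm_of_real times_divide_times_eq
    by (simp only: mult.commute)
next
  show "(\<lambda>n. (norm a + real n + 1) / (b + real n + 1)) \<longlonglongrightarrow> 1"
  proof -
    define A where "A = norm a"
    show ?thesis unfolding A_def[symmetric] by real_asymp
  qed
qed (use assms in simp)

lemma subexponential_summable:
  fixes f :: "nat \<Rightarrow> 'a :: {real_normed_field, banach}"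
  assumes "subexponential f" "norm z < 1"
  shows "summable (\<lambda>n. f n * z ^ n)"
proof -
  \<comment> \<open>The maximum keeps \<open>r\<close> positive when \<open>z = 0\<close>; the
    choice of \<open>q\<close> below gives \<open>q * r = sqrt r < 1\<close>, a convergent geometric
    majorant.\<close>
  define r where "r = max (norm z) (1 / 2)"
  have r: "norm z \<le> r" "0 < r" "r < 1" using assms by (auto simp: r_def)
  define q where "q = 1 / sqrt r"
  have q: "q > 1" "q * r = sqrt r" using r by (auto simp: q_def real_div_sqrt)
  obtain K where K: "K \<ge> 0" "\<And>n. norm (f n) \<le> K * q ^ n" using subexponentialD[OF assms(1) q(1)] by blast
  show ?thesis
  proof (rule summable_comparison_test')
    show "summable (\<lambda>n. K * sqrt r ^ n)"
      using r by (intro summable_mult summable_geometric) auto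
    show "norm (f n * z ^ n) \<le> K * sqrt r ^ n" for n
    proof -
      have "norm (f n * z ^ n) \<le> (K * q ^ n) * r ^ n"
        unfolding norm_mult norm_power using K r q by (intro mult_mono power_mono) auto
      also have "\<dots> = K * sqrt r ^ n" unfolding q(2)[symmetric] by (simp add: power_mult_distrib)
      finally show ?thesis .
    qed
  qed
qed

lemma subexponential_conv_radius:
  fixes f :: "nat \<Rightarrow> 'a :: {real_normed_field, banach}"
  assumes "subexponential f"
  shows "conv_radius f \<ge> 1"
proof (rule conv_radius_geI_ex)
  fix r :: real assume "0 < r" "ereal r < 1"
  then show "\<exists>z. norm z = r \<and> summable (\<lambda>n. f n * z ^ n)"
    by (intro exI[of _ "of_real r"] conjI subexponential_summable[OF assms]) auto
qed

lemma subexponential_gegenbauer_weight: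
  assumes "\<mu> > - 1 / 2"
  shows "subexponential (gegenbauer_weight \<mu>)"
proof (rule subexponentialI_ratio)
  fix n
  have "gegenbauer_weight \<mu> (Suc (Suc n)) =
     ((2 * \<mu> + 1 + real n) * (\<mu> + real n + 2) / ((\<mu> + real n + 1) * (real n + 2))) * gegenbauer_weight \<mu> (Suc n)"
    unfolding gegenbauer_weight_Suc[OF assms] using assms
    by (simp add: pochhammer_Suc divide_simps add_eq_0_iff) (simp add: algebra_simps)
  then show "norm (gegenbauer_weight \<mu> (Suc (Suc n))) \<le>
     \<bar>(2 * \<mu> + 1 + real n) * (\<mu> + real n + 2) / ((\<mu> + real n + 1) * (real n + 2))\<bar> * norm (gegenbauer_weight \<mu> (Suc n))"
    by (simp only: real_norm_def abs_mult order_refl)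
next
  show "(\<lambda>n. \<bar>(2 * \<mu> + 1 + real n) * (\<mu> + real n + 2) / ((\<mu> + real n + 1) * (real n + 2))\<bar>) \<longlonglongrightarrow> 1" by real_asymp
qed simp

text \<open>
  Poincare's argument: the three-term recurrence has the limiting form
  \<open>F (n + 2) = F n\<close>, whose characteristic roots lie on the unit circle.
\<close>
lemma subexponential_hahn_sum:
  assumes "\<gamma> > 0" "\<alpha> > 0"
  shows "subexponential (hahn_sum \<alpha> \<gamma> t)"
proof (rule subexponentialI_recurrence)
  fix n
  define P where "P = (real n + 2 * \<gamma>) * (real n + 1 + \<alpha>)"
  define Q where "Q = (real n + 1) * (real n + 2 * \<gamma> - \<alpha>)"
  define D where "D = 2 * (2 * real n + 2 * \<gamma> + 1)"
  define m where "m = max (norm (hahn_sum \<alpha> \<gamma> t n)) (norm (hahn_sum \<alpha> \<gamma> t (Suc n)))"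
  have P: "P > 0" and D: "D > 0" unfolding P_def D_def using assms by (auto intro!: mult_pos_pos add_nonneg_pos)
  \<comment> \<open>Hence the middle coefficient is linear in n while \<open>P\<close> and
    \<open>Q\<close> are quadratic: its quotient by \<open>P\<close> tends to 0, and that of
    \<open>Q\<close> tends to 1.\<close>
  have PQ: "P - Q = D * (\<alpha> / 2)" by (simp add: P_def Q_def D_def field_simps)
  have "of_real P * hahn_sum \<alpha> \<gamma> t (Suc (Suc n)) =
     of_real D * (of_real (\<alpha> / 2) - t) * hahn_sum \<alpha> \<gamma> t (Suc n) + of_real Q * hahn_sum \<alpha> \<gamma> t n"
    using hahn_recurrence[OF assms, of n t] unfolding P_def[symmetric] Q_def[symmetric] D_def[symmetric] PQ
    by (simp add: algebra_simps)
  then have "norm (of_real P * hahn_sum \<alpha> \<gamma> t (Suc (Suc n))) \<le>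
     norm (of_real D * (of_real (\<alpha> / 2) - t) * hahn_sum \<alpha> \<gamma> t (Suc n)) + norm (of_real Q * hahn_sum \<alpha> \<gamma> t n)"
    by (simp only: norm_triangle_ineq)
  then have "P * norm (hahn_sum \<alpha> \<gamma> t (Suc (Suc n))) \<le>
     D * norm (of_real (\<alpha> / 2) - t) * norm (hahn_sum \<alpha> \<gamma> t (Suc n)) + \<bar>Q\<bar> * norm (hahn_sum \<alpha> \<gamma> t n)"
    using P D by (simp add: norm_mult)
  also have "\<dots> \<le> D * norm (of_real (\<alpha> / 2) - t) * m + \<bar>Q\<bar> * m"
    using D unfolding m_def by (intro add_mono mult_left_mono) auto
  finally have "norm (hahn_sum \<alpha> \<gamma> t (Suc (Suc n))) \<le> (D * norm (of_real (\<alpha> / 2) - t) + \<bar>Q\<bar>) / P * m"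
    using P by (simp add: field_simps)
  then show "norm (hahn_sum \<alpha> \<gamma> t (Suc (Suc n))) \<le>
     (2 * (2 * real n + 2 * \<gamma> + 1) * norm (of_real (\<alpha> / 2) - t) + \<bar>(real n + 1) * (real n + 2 * \<gamma> - \<alpha>)\<bar>)
       / ((real n + 2 * \<gamma>) * (real n + 1 + \<alpha>)) *
     max (norm (hahn_sum \<alpha> \<gamma> t n)) (norm (hahn_sum \<alpha> \<gamma> t (Suc n)))"
    unfolding P_def Q_def D_def m_def .
next
  define T where "T = norm (of_real (\<alpha> / 2) - t)"
  show "(\<lambda>n. (2 * (2 * real n + 2 * \<gamma> + 1) * norm (of_real (\<alpha> / 2) - t) + \<bar>(real n + 1) * (real n + 2 * \<gamma> - \<alpha>)\<bar>)
       / ((real n + 2 * \<gamma>) * (real n + 1 + \<alpha>))) \<longlonglongrightarrow> 1"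
    unfolding T_def[symmetric] by real_asymp
qed

text \<open>A product of two geometric series dominates the double series, which may therefore be
  summed by rows or along the lines k + w j = N. The case w = 1 serves the expansion of powers of 1
  - \<rho>, the case w = 2 the series in \<rho>^2.\<close>

lemma sums_rearrange:
  fixes T :: "nat \<Rightarrow> nat \<Rightarrow> 'a :: banach"
  assumes "w > 0" and bound: "\<And>k j. norm (T k j) \<le> K * x ^ k * y ^ j"
    and "0 \<le> x" "x < 1" "0 \<le> y" "y < 1"
  obtains S where "(\<lambda>k. \<Sum>j. T k j) sums S" "(\<lambda>N. \<Sum>j\<le>N div w. T (N - w * j) j) sums S"
proof -
  have geo: "(\<lambda>n. z ^ n) summable_on UNIV" if "0 \<le> z" "z < 1" for z :: real
    using that by (subst summable_on_UNIV_nonneg_real_iff) (auto intro: summable_geometric)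
  have "(\<lambda>p. norm (K * (x ^ fst p * y ^ snd p))) summable_on Sigma UNIV (\<lambda>_. UNIV)"
    unfolding Infinite_Sum.abs_summable_on_Sigma_iff
    using assms by (auto simp: abs_mult infsum_cmult_right' infsum_cmult_left'
        intro!: geo summable_on_cmult_right summable_on_cmult_left)
  then have "(\<lambda>p. norm (T (fst p) (snd p))) summable_on Sigma UNIV (\<lambda>_. UNIV)"
    by (rule Infinite_Sum.abs_summable_on_comparison_test) (use bound in \<open>auto intro: order_trans[OF _ abs_ge_self] simp flip: mult.assoc\<close>)
  then obtain S where S: "((\<lambda>p. T (fst p) (snd p)) has_sum S) (Sigma UNIV (\<lambda>_. UNIV))"
    using abs_summable_summable summable_on_def by fastforce
  show ?thesis
  proof
    show "(\<lambda>k. \<Sum>j. T k j) sums S"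
    proof (rule has_sum_imp_sums, rule has_sum_SigmaD[OF S])
      fix k
      have "summable (\<lambda>j. norm (T k j))"
      proof (rule summable_comparison_test')
        show "summable (\<lambda>j. K * x ^ k * y ^ j)" using assms by (intro summable_mult summable_geometric) auto
      qed (use bound in auto)
      then show "((\<lambda>j. T (fst (k, j)) (snd (k, j))) has_sum (\<Sum>j. T k j)) UNIV"
        using norm_summable_imp_has_sum summable_norm_cancel by fastforce
    qed
    have "((\<lambda>p. T (fst p) (snd p)) has_sum S) (Sigma UNIV (\<lambda>_. UNIV)) \<longleftrightarrow>
          ((\<lambda>(N, j). T (N - w * j) j) has_sum S) (Sigma UNIV (\<lambda>N. {..N div w}))"
      by (rule has_sum_reindex_bij_witness[of _ "\<lambda>(N, j). (N - w * j, j)" "\<lambda>(k, j). (k + w * j, j)"])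
         (use \<open>w > 0\<close> in \<open>auto simp: less_eq_div_iff_mult_less_eq mult.commute\<close>)
    with S have "((\<lambda>(N, j). T (N - w * j) j) has_sum S) (Sigma UNIV (\<lambda>N. {..N div w}))" by blast
    then show "(\<lambda>N. \<Sum>j\<le>N div w. T (N - w * j) j) sums S"
      by (intro has_sum_imp_sums) (erule has_sum_SigmaD, simp add: has_sum_finite)
  qed
qed

section \<open>The generating function on the unit disk\<close>

lemma norm_pochhammer_le:
  fixes a :: "'a :: real_normed_field"
  assumes "norm a \<le> b"
  shows "norm (pochhammer a n) \<le> pochhammer b n"
proof (induction n)
  case (Suc n)
  have "norm (a + of_nat n) \<le> norm a + norm (of_nat n :: 'a)" by (rule norm_triangle_ineq)
  with assms have *: "norm (a + of_nat n) \<le> b + real n" by simp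
  show ?case
    unfolding pochhammer_Suc norm_mult
    using Suc * order_trans[OF norm_ge_zero Suc] by (intro mult_mono) auto
qed simp

text \<open>The quotient is dominated by the binomial coefficient of p + m over m. The bound is
  crude but explicit in p, which grows with the outer index in the double series below.\<close>

lemma norm_pochhammer_fact_le:
  fixes a :: "'a :: real_normed_field"
  assumes "norm a \<le> real p + 1"
  shows "norm (pochhammer a m / fact m) \<le> 2 ^ (p + m)"
proof -
  have "norm (pochhammer a m / fact m) \<le> pochhammer (real p + 1) m / fact m"
    unfolding norm_divide norm_fact using norm_pochhammer_le[OF assms] by (intro divide_right_mono) auto
  also have "\<dots> = real ((p + m) choose m)"
  proof -
    have "fact (p + m) = (fact p * pochhammer (1 + real p) m :: real)"
      unfolding pochhammer_fact by (rule pochhammer_product')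
    then show ?thesis by (simp add: binomial_fact add.commute)
  qed
  also have "\<dots> \<le> 2 ^ (p + m)"
    using binomial_le_pow2[of "p + m" m] by (metis of_nat_le_iff of_nat_numeral of_nat_power)
  finally show ?thesis .
qed

lemma binomial_series_pochhammer:
  fixes z a :: complex
  assumes "norm z < 1"
  shows "(\<lambda>n. pochhammer a n / fact n * z ^ n) sums (1 - z) powr (- a)"
proof -
  have "(\<lambda>n. (- a gchoose n) * (- z) ^ n) sums (1 + - z) powr (- a)"
    using assms by (intro gen_binomial_complex) simp
  moreover have "(- a gchoose n) * (- z) ^ n = pochhammer a n / fact n * z ^ n" for n
    by (simp add: gbinomial_pochhammer power_minus[of z])
  ultimately show ?thesis by simp
qed

definition hahn_gen_coeff :: "real \<Rightarrow> real \<Rightarrow> complex \<Rightarrow> nat \<Rightarrow> complex" where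
  "hahn_gen_coeff \<alpha> \<beta> t N = of_real (pochhammer (2 * \<beta> - 1) N / fact N) * hahn_sum \<alpha> \<beta> t N"

abbreviation hahn_hypergeo :: "real \<Rightarrow> real \<Rightarrow> complex \<Rightarrow> complex fps" where
  "hahn_hypergeo \<alpha> \<beta> t \<equiv> fps_hypergeo [of_real (\<beta> - 1 / 2), of_real \<beta>, t] [of_real \<alpha>, of_real \<beta>] 1"

text \<open>The upper and the lower parameter \<beta> cancel, since (\<beta>)_n is nonzero.\<close>

lemma hahn_hypergeo_nth:
  assumes "\<beta> > 0"
  shows "fps_nth (hahn_hypergeo \<alpha> \<beta> t) n =
    of_real (pochhammer (\<beta> - 1 / 2) n / pochhammer \<alpha> n) * (pochhammer t n / fact n)"
proof -
  have "pochhammer (complex_of_real \<beta>) n \<noteq> 0"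
    using pochhammer_real_nonzero[OF assms, of n] by (simp add: pochhammer_of_real)
  then show ?thesis
    by (simp add: pochhammer_of_real[symmetric])
qed

lemma subexponential_hahn_hypergeo:
  assumes "\<alpha> > 0" "\<beta> > 0"
  shows "subexponential (fps_nth (hahn_hypergeo \<alpha> \<beta> t))"
proof -
  have "subexponential (\<lambda>n. of_real (pochhammer (\<beta> - 1 / 2) n / pochhammer \<alpha> n) * (pochhammer t n / of_real (pochhammer 1 n)))"
    using subexponential_pochhammer[of \<alpha> "\<beta> - 1 / 2"] assms
    by (intro subexponential_mult subexponential_of_real subexponential_pochhammer) auto
  also have "(\<lambda>n. of_real (pochhammer (\<beta> - 1 / 2) n / pochhammer \<alpha> n) * (pochhammer t n / of_real (pochhammer 1 n))) =
      fps_nth (hahn_hypergeo \<alpha> \<beta> t)"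
    unfolding fun_eq_iff hahn_hypergeo_nth[OF assms(2)] pochhammer_of_real[symmetric] of_real_1 pochhammer_fact by simp
  finally show ?thesis .
qed

lemma subexponential_hahn_gen_coeff:
  assumes "\<alpha> > 0" "\<beta> > 0"
  shows "subexponential (hahn_gen_coeff \<alpha> \<beta> t)"
proof -
  have "subexponential (\<lambda>N. of_real (pochhammer (2 * \<beta> - 1) N / pochhammer 1 N) * hahn_sum \<alpha> \<beta> t N)"
    using subexponential_pochhammer[of 1 "2 * \<beta> - 1"] assms
    by (intro subexponential_mult subexponential_of_real subexponential_hahn_sum) auto
  then show ?thesis
    unfolding hahn_gen_coeff_def[abs_def] pochhammer_fact .
qed

text \<open>Each power (1 - \<rho>)^(1 - 2\<beta> - 2n) is expanded by the binomial series and the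
  double series is regrouped by powers of \<rho>. Smallness of \<rho> secures absolute
  convergence.\<close>

lemma hahn_generating_function_small:
  assumes "\<alpha> > 0" "\<beta> > 0" "norm \<rho> < 1 / 64"
  shows "(\<lambda>N. hahn_gen_coeff \<alpha> \<beta> t N * \<rho> ^ N) sums
    ((1 - \<rho>) powr of_real (1 - 2 * \<beta>) * eval_fps (hahn_hypergeo \<alpha> \<beta> t) (- (4 * \<rho>) / (1 - \<rho>)\<^sup>2))"
proof -
  define s where "s = complex_of_real (2 * \<beta> - 1)"
  define e where "e = (\<lambda>n. of_real (pochhammer (\<beta> - 1 / 2) n / pochhammer \<alpha> n) * (pochhammer t n / fact n))"
  define T where "T = (\<lambda>n m. e n * (- 4) ^ n * \<rho> ^ n * (pochhammer (s + of_nat (2 * n)) m / fact m * \<rho> ^ m))"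
  have "1 - \<rho> \<noteq> 0" using assms(3) by auto
  have "e = fps_nth (hahn_hypergeo \<alpha> \<beta> t)"
    unfolding e_def fun_eq_iff hahn_hypergeo_nth[OF assms(2)] by simp
  then have "subexponential e"
    using subexponential_hahn_hypergeo[OF assms(1,2), of t] by simp
  then obtain K where K: "K \<ge> 0" "\<And>n. norm (e n) \<le> K * 2 ^ n"
    by (rule subexponentialD[of e 2]) auto
  obtain p where p: "norm s \<le> real p" using real_arch_simple by blast
  \<comment> \<open>The factor 32 is 2 * 4 * 4: from the growth of \<open>e\<close>, from (-4)^n,
    and from the 2n in the Pochhammer parameter. With \<rho> below 1/64 both ratios are less than
    1.\<close>
  have bound: "norm (T n m) \<le> (K * 2 ^ p) * (32 * norm \<rho>) ^ n * (2 * norm \<rho>) ^ m" for n m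
  proof -
    have "norm (s + of_nat (2 * n)) \<le> norm s + norm (of_nat (2 * n) :: complex)" by (rule norm_triangle_ineq)
    with p have "norm (s + of_nat (2 * n)) \<le> real (p + 2 * n) + 1" by simp
    then have *: "norm (pochhammer (s + of_nat (2 * n)) m / fact m) \<le> 2 ^ (p + 2 * n + m)"
      by (rule norm_pochhammer_fact_le)
    have "norm (T n m) = norm (e n) * 4 ^ n * norm \<rho> ^ n * (norm (pochhammer (s + of_nat (2 * n)) m / fact m) * norm \<rho> ^ m)"
      by (simp only: T_def norm_mult norm_power norm_minus_cancel norm_numeral)
    also have "\<dots> \<le> (K * 2 ^ n) * 4 ^ n * norm \<rho> ^ n * (2 ^ (p + 2 * n + m) * norm \<rho> ^ m)"
      using K * by (intro mult_mono) auto
    also have "(2 :: real) ^ (p + 2 * n + m) = 2 ^ p * 4 ^ n * 2 ^ m"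
      by (simp add: power_add power_mult)
    also have "(K * 2 ^ n) * 4 ^ n * norm \<rho> ^ n * (2 ^ p * 4 ^ n * 2 ^ m * norm \<rho> ^ m) =
        (K * 2 ^ p) * ((2 * 4 * 4) * norm \<rho>) ^ n * (2 * norm \<rho>) ^ m"
      by (simp only: power_mult_distrib mult_ac)
    finally show ?thesis by simp
  qed
  obtain S where S: "(\<lambda>n. \<Sum>m. T n m) sums S" "(\<lambda>N. \<Sum>m\<le>N div 1. T (N - 1 * m) m) sums S"
    by (rule sums_rearrange[of 1 T, OF _ bound]) (use assms(3) in auto)
  define z where "z = - (4 * \<rho>) / (1 - \<rho>)\<^sup>2"
  have inner: "(\<Sum>m. T n m) = (1 - \<rho>) powr (- s) * (e n * z ^ n)" for n
  proof -
    have "(\<lambda>m. T n m) sums (e n * (- 4) ^ n * \<rho> ^ n * (1 - \<rho>) powr (- (s + of_nat (2 * n))))"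
      unfolding T_def using assms(3) by (intro sums_mult binomial_series_pochhammer) auto
    \<comment> \<open>Only an integer power is split off, so no change of branch can occur; it
      combines with (-4)^n \<rho>^n to \<open>z ^ n\<close>.\<close>
    moreover have "(1 - \<rho>) powr (- (s + of_nat (2 * n))) = (1 - \<rho>) powr (- s) / ((1 - \<rho>)\<^sup>2) ^ n"
    proof -
      have "- (s + of_nat (2 * n)) = - s - of_nat (2 * n)" by simp
      then have "(1 - \<rho>) powr (- (s + of_nat (2 * n))) = (1 - \<rho>) powr (- s) / (1 - \<rho>) powr of_nat (2 * n)"
        by (simp only: powr_diff)
      also have "(1 - \<rho>) powr of_nat (2 * n) = ((1 - \<rho>)\<^sup>2) ^ n"
        using \<open>1 - \<rho> \<noteq> 0\<close> by (simp only: powr_nat' power_mult simp_thms)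
      finally show ?thesis .
    qed
    moreover have "z ^ n = (- 4) ^ n * \<rho> ^ n / ((1 - \<rho>)\<^sup>2) ^ n"
      unfolding z_def by (simp only: power_divide mult_minus_left[symmetric] power_mult_distrib)
    ultimately show ?thesis by (simp add: sums_iff mult_ac)
  qed
  have nz: "(1 - \<rho>) powr (- s) \<noteq> 0" using \<open>1 - \<rho> \<noteq> 0\<close> by simp
  have "(\<lambda>n. e n * z ^ n) sums (S / (1 - \<rho>) powr (- s))"
    using sums_divide[OF S(1), of "(1 - \<rho>) powr (- s)"] nz by (simp add: inner)
  then have "eval_fps (hahn_hypergeo \<alpha> \<beta> t) z = S / (1 - \<rho>) powr (- s)"
    unfolding eval_fps_def hahn_hypergeo_nth[OF assms(2)] e_def by (simp add: sums_iff)
  then have S_eq: "S = (1 - \<rho>) powr (- s) * eval_fps (hahn_hypergeo \<alpha> \<beta> t) z"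
    using nz by simp
  have diag: "(\<Sum>m\<le>N div 1. T (N - 1 * m) m) = hahn_gen_coeff \<alpha> \<beta> t N * \<rho> ^ N" for N
  proof -
    have "(\<Sum>m\<le>N div 1. T (N - 1 * m) m) = (\<Sum>n\<le>N. T n (N - n))"
      by (rule sum.reindex_bij_witness[of _ "\<lambda>n. N - n" "\<lambda>n. N - n"]) auto
    also have "\<dots> = hahn_gen_coeff \<alpha> \<beta> t N * \<rho> ^ N"
      unfolding hahn_gen_coeff_def hahn_sum_def sum_distrib_left sum_distrib_right
    proof (intro sum.cong refl)
      fix n assume "n \<in> {..N}"
      then have n: "n \<le> N" by simp
      define c where "c = pochhammer (2 * \<beta> - 1) N / fact N *
         (pochhammer (- real N) n * pochhammer (real N + 2 * \<beta> - 1) n / pochhammer \<beta> n)"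
      \<comment> \<open>This is \<open>hahn_sum_coeff\<close> at \<nu> = \<beta> - 1/2; it
        identifies the regrouped terms with those of \<open>hahn_sum\<close>.\<close>
      have c: "c = (- 4) ^ n * pochhammer (\<beta> - 1 / 2) n * (pochhammer (2 * \<beta> - 1 + real (2 * n)) (N - n) / fact (N - n))"
        using hahn_sum_coeff[of "\<beta> - 1 / 2" n N] n assms(2) unfolding c_def by (simp add: algebra_simps)
      have s: "s + of_nat (2 * n) = of_real (2 * \<beta> - 1 + real (2 * n))" by (simp add: s_def)
      have "T n (N - n) = of_real c * (pochhammer t n / of_real (pochhammer \<alpha> n * fact n)) * (\<rho> ^ n * \<rho> ^ (N - n))"
        unfolding c T_def e_def s pochhammer_of_real by (simp add: mult_ac)
      also have "\<rho> ^ n * \<rho> ^ (N - n) = \<rho> ^ N" using n by (simp flip: power_add)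
      finally show "T n (N - n) = of_real (pochhammer (2 * \<beta> - 1) N / fact N) *
         (of_real (pochhammer (- real N) n * pochhammer (real N + 2 * \<beta> - 1) n /
           (pochhammer \<alpha> n * pochhammer \<beta> n * fact n)) * pochhammer t n) * \<rho> ^ N"
        unfolding c_def by (simp add: mult_ac)
    qed
    finally show ?thesis .
  qed
  have "- s = of_real (1 - 2 * \<beta>)" by (simp add: s_def)
  with S(2) show ?thesis unfolding diag S_eq z_def by simp
qed

section \<open>The biholomorphic map between the unit disk and the cut plane\<close>

lemma square_notin_nonpos_Reals:
  assumes "Re w > 0"
  shows "w\<^sup>2 \<notin> \<real>\<^sub>\<le>\<^sub>0"
proof
  assume "w\<^sup>2 \<in> \<real>\<^sub>\<le>\<^sub>0"
  then have "Re (w\<^sup>2) \<le> 0" "Im (w\<^sup>2) = 0" by (auto simp: complex_nonpos_Reals_iff)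
  with assms have "Re w * Re w \<le> 0" by (auto simp: power2_eq_square)
  with mult_pos_pos[OF assms assms] show False by linarith
qed

lemma Re_csqrt_pos:
  assumes "z \<notin> \<real>\<^sub>\<le>\<^sub>0"
  shows "Re (csqrt z) > 0"
proof (rule ccontr)
  assume "\<not> Re (csqrt z) > 0"
  then have "Re (csqrt z) = 0" using Re_csqrt[of z] by linarith
  then have "(csqrt z)\<^sup>2 \<in> \<real>\<^sub>\<le>\<^sub>0"
    by (simp only: complex_nonpos_Reals_iff power2_eq_square times_complex.sel) simp
  with assms show False by simp
qed

lemma cut_plane_iff: "z \<in> cut_plane \<longleftrightarrow> 1 - z \<notin> \<real>\<^sub>\<le>\<^sub>0"
  by (auto simp: cut_plane_def complex_nonpos_Reals_iff complex_eq_iff image_iff Bex_def)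

lemma norm_Cayley_less_1:
  assumes "Re w > 0"
  shows "norm ((w - 1) / (w + 1)) < 1"
proof -
  have "(norm (w - 1))\<^sup>2 < (norm (w + 1))\<^sup>2"
    unfolding cmod_power2 using assms by (simp add: power2_eq_square algebra_simps)
  then have "norm (w - 1) < norm (w + 1)" by (rule power2_less_imp_less) simp
  then show ?thesis by (simp add: norm_divide divide_simps)
qed

text \<open>Inverse of \<rho> -> -4\<rho> / (1 - \<rho>)^2, a multiple of the Koebe function. If z
  is the image of \<rho>, then 1 - z is the square of w = (1 + \<rho>) / (1 - \<rho>); this w lies
  in the right half-plane, hence is the principal root, and \<rho> = (w - 1) / (w + 1).\<close>

definition koebe_inv :: "complex \<Rightarrow> complex" where
  "koebe_inv z = (csqrt (1 - z) - 1) / (csqrt (1 - z) + 1)"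

lemma koebe_inv:
  assumes "z \<in> cut_plane"
  shows "norm (koebe_inv z) < 1" "- (4 * koebe_inv z) / (1 - koebe_inv z)\<^sup>2 = z"
proof -
  define w where "w = csqrt (1 - z)"
  have w: "Re w > 0" unfolding w_def using assms by (intro Re_csqrt_pos) (simp add: cut_plane_iff)
  show "norm (koebe_inv z) < 1"
    unfolding koebe_inv_def w_def[symmetric] by (rule norm_Cayley_less_1[OF w])
  have nz: "w + 1 \<noteq> 0" using w by (auto simp: complex_eq_iff)
  have r: "koebe_inv z = (w - 1) / (w + 1)" "1 - koebe_inv z = 2 / (w + 1)"
    unfolding koebe_inv_def w_def[symmetric] using nz by (auto simp: field_simps)
  have "- (4 * koebe_inv z) / (1 - koebe_inv z)\<^sup>2 = 1 - w\<^sup>2"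
  proof -
    have "4 * ((w - 1) / (w + 1)) / (2 / (w + 1))\<^sup>2 = w\<^sup>2 - 1"
      using nz by (simp add: power2_eq_square) (simp add: algebra_simps)
    then show ?thesis unfolding r(2) unfolding r(1) by simp
  qed
  then show "- (4 * koebe_inv z) / (1 - koebe_inv z)\<^sup>2 = z"
    by (simp add: w_def)
qed

lemma koebe_inv_koebe:
  assumes "norm \<rho> < 1"
  shows "- (4 * \<rho>) / (1 - \<rho>)\<^sup>2 \<in> cut_plane" "koebe_inv (- (4 * \<rho>) / (1 - \<rho>)\<^sup>2) = \<rho>"
proof -
  define z where "z = - (4 * \<rho>) / (1 - \<rho>)\<^sup>2"
  define w where "w = (1 + \<rho>) / (1 - \<rho>)"
  have nz: "1 - \<rho> \<noteq> 0" using assms by auto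
  have zw: "1 - z = w\<^sup>2"
    unfolding z_def w_def using nz by (simp add: divide_simps) (simp add: power2_eq_square algebra_simps)
  have "Re w > 0"
  proof -
    have "(norm \<rho>)\<^sup>2 < 1" using assms by (simp add: power_less_one_iff)
    then have "(Re \<rho>)\<^sup>2 + (Im \<rho>)\<^sup>2 < 1" by (simp only: cmod_power2)
    \<comment> \<open>This real part is 1 - |\<rho>|^2.\<close>
    then have "Re ((1 + \<rho>) * cnj (1 - \<rho>)) > 0"
      by (simp add: power2_eq_square algebra_simps)
    moreover have "w = (1 + \<rho>) * cnj (1 - \<rho>) / of_real ((norm (1 - \<rho>))\<^sup>2)"
      unfolding w_def by (subst complex_div_cnj) simp
    ultimately show ?thesis using nz by (simp only: Re_divide_of_real) simp
  qed
  then show "- (4 * \<rho>) / (1 - \<rho>)\<^sup>2 \<in> cut_plane"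
    unfolding cut_plane_iff z_def[symmetric] zw by (rule square_notin_nonpos_Reals)
  have "csqrt (1 - z) = w" unfolding zw using \<open>Re w > 0\<close> by (intro csqrt_square) auto
  moreover have "w - 1 = 2 * \<rho> / (1 - \<rho>)" "w + 1 = 2 / (1 - \<rho>)"
    unfolding w_def using nz by (auto simp: field_simps)
  ultimately show "koebe_inv (- (4 * \<rho>) / (1 - \<rho>)\<^sup>2) = \<rho>"
    unfolding z_def[symmetric] koebe_inv_def using nz by simp
qed

lemma holomorphic_on_koebe_inv: "koebe_inv holomorphic_on cut_plane"
proof -
  have nz: "csqrt (1 - z) + 1 \<noteq> 0" if "z \<in> cut_plane" for z
  proof -
    have "Re (csqrt (1 - z)) > 0" using that by (intro Re_csqrt_pos) (simp add: cut_plane_iff)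
    then have "Re (csqrt (1 - z) + 1) > 0" by (simp del: csqrt.sel)
    then show ?thesis by (metis less_irrefl zero_complex.sel(1))
  qed
  have "(\<lambda>z. (csqrt (1 - z) - 1) / (csqrt (1 - z) + 1)) holomorphic_on cut_plane"
    by (intro holomorphic_intros) (use nz in \<open>auto simp: cut_plane_iff\<close>)
  then show ?thesis by (simp add: koebe_inv_def[abs_def])
qed

text \<open>Removes the bound 1/64: the generating function, pulled back to the cut plane by
  \<open>koebe_inv\<close>, is holomorphic there and agrees with the 3F2 series near 0, so it is the
  continuation used by \<open>hypergeo\<close>.\<close>

lemma hahn_generating_function:
  assumes "\<alpha> > 0" "\<beta> > 0" "norm \<rho> < 1"
  shows "(\<lambda>N. hahn_gen_coeff \<alpha> \<beta> t N * \<rho> ^ N) sums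
    ((1 - \<rho>) powr of_real (1 - 2 * \<beta>) *
     hypergeo [of_real (\<beta> - 1 / 2), of_real \<beta>, t] [of_real \<alpha>, of_real \<beta>] (- (4 * \<rho>) / (1 - \<rho>)\<^sup>2))"
proof -
  define C where "C = Abs_fps (hahn_gen_coeff \<alpha> \<beta> t)"
  define s where "s = complex_of_real (1 - 2 * \<beta>)"
  define f where "f = (\<lambda>z. (1 - koebe_inv z) powr (- s) * eval_fps C (koebe_inv z))"
  define H where "H = hahn_hypergeo \<alpha> \<beta> t"
  have C_rad: "fps_conv_radius C \<ge> 1"
    unfolding fps_conv_radius_def C_def
    using subexponential_conv_radius[OF subexponential_hahn_gen_coeff[OF assms(1,2), of t]] by simp
  have H_rad: "fps_conv_radius H \<ge> 1"
    unfolding fps_conv_radius_def H_def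
    using subexponential_conv_radius[OF subexponential_hahn_hypergeo[OF assms(1,2), of t]] by simp
  have C_sums: "(\<lambda>N. hahn_gen_coeff \<alpha> \<beta> t N * r ^ N) sums eval_fps C r" if "norm r < 1" for r
  proof -
    have "ereal (norm r) < fps_conv_radius C" using that C_rad by (meson ereal_less(3) less_le_trans)
    from sums_eval_fps[OF this] show ?thesis by (simp add: C_def)
  qed
  have f_holo: "f holomorphic_on cut_plane"
  proof -
    have "eval_fps C holomorphic_on ball 0 1"
      by (intro holomorphic_on_eval_fps) (auto intro!: less_le_trans[OF _ C_rad])
    then have "(eval_fps C \<circ> koebe_inv) holomorphic_on cut_plane"
      by (intro holomorphic_on_compose_gen[OF holomorphic_on_koebe_inv]) (auto simp: koebe_inv)
    \<comment> \<open>The values of \<open>1 - koebe_inv z\<close> have positive real part, so the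
      principal power is holomorphic.\<close>
    moreover have "1 - koebe_inv z \<notin> \<real>\<^sub>\<le>\<^sub>0" if "z \<in> cut_plane" for z
    proof -
      have "Re (koebe_inv z) < 1" using koebe_inv(1)[OF that] complex_Re_le_cmod le_less_trans by blast
      then show ?thesis by (simp add: complex_nonpos_Reals_iff)
    qed
    ultimately show ?thesis
      unfolding f_def o_def by (intro holomorphic_intros holomorphic_on_koebe_inv) auto
  qed
  have cancel: "(1 - r) powr (- s) * ((1 - r) powr s * h) = h" if "norm r < 1" for r h
  proof -
    have "(1 - r) powr s \<noteq> 0" using that by auto
    then show ?thesis by (simp add: powr_minus field_simps)
  qed
  \<comment> \<open>By continuity of \<open>koebe_inv\<close> at its zero 0;
    \<open>e \<le> 1\<close> keeps the ball inside the unit disk.\<close>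
  obtain e where e: "e > 0" "e \<le> 1" "\<And>z. z \<in> ball 0 e \<Longrightarrow> norm (koebe_inv z) < 1 / 64"
  proof -
    have "continuous_on cut_plane koebe_inv"
      using holomorphic_on_koebe_inv by (rule holomorphic_on_imp_continuous_on)
    moreover have "0 \<in> cut_plane" using ball_subset_cut_plane by force
    ultimately have "isCont koebe_inv 0"
      using open_cut_plane by (auto simp: continuous_on_eq_continuous_at)
    moreover have "koebe_inv 0 = 0" by (simp add: koebe_inv_def)
    ultimately obtain d where "d > 0" "\<And>z. norm z < d \<Longrightarrow> norm (koebe_inv z) < 1 / 64"
      unfolding continuous_at_eps_delta by (metis diff_zero dist_norm zero_less_divide_1_iff zero_less_numeral)
    then show ?thesis by (intro that[of "min d 1"]) auto
  qed
  have f_small: "f z = eval_fps H z" if "z \<in> ball 0 e" for z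
  proof -
    define r where "r = koebe_inv z"
    have z: "z \<in> cut_plane" using that e(2) ball_subset_cut_plane by auto
    have r: "norm r < 1 / 64" unfolding r_def by (rule e(3)[OF that])
    have "eval_fps C r = (1 - r) powr s * eval_fps H (- (4 * r) / (1 - r)\<^sup>2)"
      using hahn_generating_function_small[OF assms(1,2) r, of t] C_sums[of r] r
      unfolding s_def H_def by (intro sums_unique2) auto
    also have "- (4 * r) / (1 - r)\<^sup>2 = z" unfolding r_def by (rule koebe_inv(2)[OF z])
    finally show ?thesis
      unfolding f_def r_def[symmetric] using r by (simp add: cancel)
  qed
  \<comment> \<open>The identity theorem extends the equality near 0 to the whole unit disk, as
    \<open>hypergeo_eq_continuation\<close> requires.\<close>
  have f_ball: "f u = eval_fps H u" if "norm u < 1" for u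
  proof (rule analytic_continuation_open[of "ball 0 e" "ball 0 1" f "eval_fps H"])
    show "f holomorphic_on ball 0 1" using f_holo ball_subset_cut_plane by (rule holomorphic_on_subset)
    show "eval_fps H holomorphic_on ball 0 1"
      by (intro holomorphic_on_eval_fps) (auto intro!: less_le_trans[OF _ H_rad])
  qed (use e f_small that in auto)
  have "hypergeo [of_real (\<beta> - 1 / 2), of_real \<beta>, t] [of_real \<alpha>, of_real \<beta>] (- (4 * \<rho>) / (1 - \<rho>)\<^sup>2) =
      f (- (4 * \<rho>) / (1 - \<rho>)\<^sup>2)"
    using f_holo koebe_inv_koebe(1)[OF assms(3)] f_ball
    by (intro hypergeo_eq_continuation) (auto simp: H_def)
  also have "\<dots> = (1 - \<rho>) powr (- s) * eval_fps C \<rho>"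
    unfolding f_def koebe_inv_koebe(2)[OF assms(3)] ..
  finally have "hypergeo [of_real (\<beta> - 1 / 2), of_real \<beta>, t] [of_real \<alpha>, of_real \<beta>] (- (4 * \<rho>) / (1 - \<rho>)\<^sup>2) =
      (1 - \<rho>) powr (- s) * eval_fps C \<rho>" .
  moreover have powr_nz: "(1 - \<rho>) powr s \<noteq> 0" using assms(3) by auto
  ultimately show ?thesis
    using C_sums[OF assms(3)] unfolding s_def[symmetric] by (simp only: powr_minus mult.assoc[symmetric]) simp
qed

section \<open>Expansion in continuous Hahn polynomials\<close>

lemma cont_hahn_eq_hahn_sum:
  assumes "Re a > 0" "Re c > 0" "Im a = Im c"
  shows "cont_hahn k (of_real x) a c =
    \<i> ^ k * of_real (pochhammer (2 * Re a) k * pochhammer (Re a + Re c) k / fact k) *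
      hahn_sum (2 * Re a) (Re a + Re c) (a + \<i> * of_real x) k"
proof -
  define t where "t = a + \<i> * of_real x"
  have ac: "a + cnj c = of_real (Re a + Re c)" using assms by (simp add: complex_eq_iff)
  \<comment> \<open>The point 1 lies on the cut, so \<open>hypergeo\<close> there is the series
    itself, which terminates.\<close>
  have "(1 :: complex) \<notin> cut_plane" by (auto simp: cut_plane_def image_iff)
  then have "hypergeo [- of_nat k, of_nat k + of_real (2 * Re a + 2 * Re c - 1), t]
      [of_real (2 * Re a), of_real (Re a + Re c)] 1 =
      (\<Sum>n. of_real (pochhammer (- real k) n * pochhammer (real k + 2 * (Re a + Re c) - 1) n /
        (pochhammer (2 * Re a) n * pochhammer (Re a + Re c) n * fact n)) * pochhammer t n)"
    unfolding hypergeo_def eval_fps_hypergeo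
    by (simp add: pochhammer_of_real[symmetric] algebra_simps)
  also have "\<dots> = hahn_sum (2 * Re a) (Re a + Re c) t k"
    unfolding hahn_sum_def by (rule suminf_finite) (auto simp: pochhammer_of_nat_eq_0_iff)
  finally show ?thesis
    unfolding cont_hahn_def ac t_def[symmetric] pochhammer_of_real
    by (simp only: of_real_mult of_real_divide of_real_fact)
qed

text \<open>Reconciles the theorem with the connection formula: on the left stands the coefficient
  of the theorem times the normalization of p_k without i^k, after cancellation of (2 Re a)_k. The
  duplication formula is applied to (2\<beta> - 1)_(2k) and to (2\<gamma>)_(2k).\<close>

lemma gegenbauer_weight_expand:
  assumes "\<gamma> > 0" "\<beta> > 0"
  shows "pochhammer (2 * \<beta> - 1) (2 * k) * pochhammer \<gamma> k /
      (pochhammer \<beta> k * pochhammer (2 * \<gamma> + real k - 1) k * fact k) =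
    pochhammer (\<beta> - 1 / 2) k / pochhammer (\<gamma> + 1 / 2) k * gegenbauer_weight (\<gamma> - 1 / 2) k"
proof -
  have 1: "pochhammer (2 * \<beta> - 1) (2 * k) = 4 ^ k * pochhammer (\<beta> - 1 / 2) k * pochhammer \<beta> k"
    using pochhammer_double[of "\<beta> - 1 / 2" k] by (simp add: power_mult)
  have 2: "pochhammer (2 * \<gamma>) (2 * k) = 4 ^ k * pochhammer \<gamma> k * pochhammer (\<gamma> + 1 / 2) k"
    using pochhammer_double[of \<gamma> k] by (simp add: power_mult)
  have "2 * (\<gamma> - 1 / 2) + 1 = 2 * \<gamma>" "2 * (\<gamma> - 1 / 2) + real k = 2 * \<gamma> + real k - 1" by simp_all
  moreover have "pochhammer \<beta> k \<noteq> 0" "pochhammer (\<gamma> + 1 / 2) k \<noteq> 0"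
    using assms by (auto intro!: pochhammer_real_nonzero)
  ultimately show ?thesis
    unfolding gegenbauer_weight_def by (simp only: 1 2) simp
qed

lemma hypergeo_2_1_sums:
  fixes p q r :: real
  assumes "r > 0" "norm z < 1"
  shows "(\<lambda>j. of_real (pochhammer p j / pochhammer r j * (pochhammer q j / fact j)) * z ^ j) sums
    hypergeo [of_real p, of_real q] [of_real r] z"
proof -
  have "subexponential (\<lambda>j. pochhammer p j / of_real (pochhammer r j) * (pochhammer q j / of_real (pochhammer 1 j)))"
    using assms by (intro subexponential_mult subexponential_pochhammer) auto
  then have "subexponential (\<lambda>j. of_real (pochhammer p j / pochhammer r j * (pochhammer q j / fact j)) :: complex)"
    by (intro subexponential_of_real) (simp add: pochhammer_fact)
  then have "summable (\<lambda>j. of_real (pochhammer p j / pochhammer r j * (pochhammer q j / fact j)) * z ^ j)"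
    by (rule subexponential_summable) fact
  moreover have "hypergeo [of_real p, of_real q] [of_real r] z =
      (\<Sum>j. of_real (pochhammer p j / pochhammer r j * (pochhammer q j / fact j)) * z ^ j)"
    using assms unfolding hypergeo_def eval_fps_hypergeo by (simp add: pochhammer_of_real)
  ultimately show ?thesis by (simp add: summable_sums)
qed

text \<open>The coefficient in \<open>hahn_connection\<close> written with N = k + 2j, so that N - j
  = k + j and N - 2j = k.\<close>

definition connection_term :: "real \<Rightarrow> real \<Rightarrow> nat \<Rightarrow> nat \<Rightarrow> real" where
  "connection_term \<beta> \<gamma> k j = pochhammer (\<beta> - 1 / 2) (k + j) / pochhammer (\<gamma> + 1 / 2) (k + j) *
     (pochhammer (\<beta> - \<gamma>) j / fact j) * gegenbauer_weight (\<gamma> - 1 / 2) k"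

text \<open>The three factors grow subexponentially in k + j, j and k; together they cost q^(2k)
  q^(2j), a product form fit for \<open>sums_rearrange\<close>.\<close>

lemma connection_term_bound:
  assumes "\<gamma> > 0" "q > 1"
  obtains K where "K \<ge> 0" "\<And>k j. \<bar>connection_term \<beta> \<gamma> k j\<bar> \<le> K * (q\<^sup>2) ^ k * (q\<^sup>2) ^ j"
proof -
  have "subexponential (\<lambda>n. pochhammer (\<beta> - 1 / 2) n / pochhammer (\<gamma> + 1 / 2) n)"
    using subexponential_pochhammer[of "\<gamma> + 1 / 2" "\<beta> - 1 / 2"] assms by simp
  then obtain A where A: "A \<ge> 0" "\<And>n. norm (pochhammer (\<beta> - 1 / 2) n / pochhammer (\<gamma> + 1 / 2) n) \<le> A * q ^ n"
    using subexponentialD assms(2) by blast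
  have "subexponential (\<lambda>n. pochhammer (\<beta> - \<gamma>) n / fact n)"
    using subexponential_pochhammer[of 1 "\<beta> - \<gamma>"] by (simp add: pochhammer_fact)
  then obtain B where B: "B \<ge> 0" "\<And>n. norm (pochhammer (\<beta> - \<gamma>) n / fact n) \<le> B * q ^ n"
    using subexponentialD assms(2) by blast
  obtain C where C: "C \<ge> 0" "\<And>n. norm (gegenbauer_weight (\<gamma> - 1 / 2) n) \<le> C * q ^ n"
    using subexponentialD[OF subexponential_gegenbauer_weight assms(2), of "\<gamma> - 1 / 2"] assms(1) by auto
  have "\<bar>connection_term \<beta> \<gamma> k j\<bar> \<le> (A * B * C) * (q\<^sup>2) ^ k * (q\<^sup>2) ^ j" for k j
  proof -
    have "norm (connection_term \<beta> \<gamma> k j) \<le> (A * q ^ (k + j)) * (B * q ^ j) * (C * q ^ k)"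
      unfolding connection_term_def norm_mult[of _ "gegenbauer_weight _ _"] norm_mult[of "_ / pochhammer (\<gamma> + 1 / 2) _"]
      using A B C assms(2) by (intro mult_mono) auto
    also have "\<dots> = (A * B * C) * (q\<^sup>2) ^ k * (q\<^sup>2) ^ j"
      by (simp only: power_add power2_eq_square power_mult_distrib mult_ac)
    finally show ?thesis by simp
  qed
  moreover have "A * B * C \<ge> 0" using A B C by simp
  ultimately show ?thesis using that by blast
qed

theorem theorem4p4:
  fixes \<rho> a b c :: complex and x :: real
  assumes "norm \<rho> < 1"
    and "Re a > 0" and "Re b > 0" and "Re c > 0"
    and "Im a = Im b" and "Im b = Im c"
  shows
    "(\<lambda>k. complex_of_real
            (pochhammer (2 * Re a + 2 * Re b - 1) (2 * k) /
             (pochhammer (2 * Re a) k * pochhammer (Re a + Re b) k *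
              pochhammer (2 * Re a + 2 * Re c + real k - 1) k)) *
          hypergeo [of_real (Re a + Re b + real k - 1 / 2), of_real (Re b - Re c)]
                   [of_real (Re a + Re c + real k + 1 / 2)] (\<rho>\<^sup>2) *
          (- \<i> * \<rho>) ^ k * cont_hahn k (of_real x) a c)
     sums
     ((1 - \<rho>) powr of_real (1 - 2 * Re a - 2 * Re b) *
      hypergeo [of_real (Re a + Re b - 1 / 2), of_real (Re a + Re b), a + \<i> * of_real x]
               [of_real (2 * Re a), a + cnj b] (- (4 * \<rho>) / (1 - \<rho>)\<^sup>2))"
proof -
  define \<alpha> \<beta> \<gamma> t where "\<alpha> = 2 * Re a" and "\<beta> = Re a + Re b" and "\<gamma> = Re a + Re c" and "t = a + \<i> * of_real x"
  have pos: "\<alpha> > 0" "\<beta> > 0" "\<gamma> > 0" using assms by (auto simp: \<alpha>_def \<beta>_def \<gamma>_def)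
  have ab: "a + cnj b = of_real \<beta>" using assms by (simp add: complex_eq_iff \<beta>_def)
  define F where "F = hahn_sum \<alpha> \<gamma> t"
  \<comment> \<open>The row sums over j are the terms of the theorem; the sums along k + 2j = N are
    the terms of the generating function.\<close>
  define T where "T = (\<lambda>k j. of_real (connection_term \<beta> \<gamma> k j) * F k * \<rho> ^ (k + 2 * j))"
  define r where "r = max (norm \<rho>) (1 / 2)"
  have r: "norm \<rho> \<le> r" "0 < r" "r < 1" using assms(1) by (auto simp: r_def)
  \<comment> \<open>With q^4 r = 1, the growth q^3 per step in k (two from
    \<open>connection_term\<close>, one from \<open>F\<close>) and q^2 per step in j is outweighed
    by the powers r and r^2.\<close>
  define q where "q = 1 / root 4 r"
  have q: "q > 1" "q ^ 4 * r = 1"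
    using r by (auto simp: q_def power_divide real_root_lt_1_iff)
  have q3: "q ^ 3 * r < 1" "q ^ 4 * r\<^sup>2 < 1"
  proof -
    have "q ^ 3 * r * 1 < q ^ 3 * r * q" using q r by (intro mult_strict_left_mono) auto
    also have "\<dots> = 1" using q by (simp add: power_numeral_reduce mult_ac)
    finally show "q ^ 3 * r < 1" by simp
    show "q ^ 4 * r\<^sup>2 < 1" using q(2) r by (simp add: power2_eq_square flip: mult.assoc)
  qed
  obtain K where K: "K \<ge> 0" "\<And>k j. \<bar>connection_term \<beta> \<gamma> k j\<bar> \<le> K * (q\<^sup>2) ^ k * (q\<^sup>2) ^ j"
    using connection_term_bound[OF pos(3) q(1)] by blast
  obtain L where L: "L \<ge> 0" "\<And>k. norm (F k) \<le> L * q ^ k"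
    using subexponentialD[OF subexponential_hahn_sum[OF pos(3,1)] q(1)] unfolding F_def by blast
  have bound: "norm (T k j) \<le> (K * L) * (q ^ 3 * r) ^ k * (q\<^sup>2 * r\<^sup>2) ^ j" for k j
  proof -
    have "norm (T k j) = \<bar>connection_term \<beta> \<gamma> k j\<bar> * norm (F k) * norm \<rho> ^ (k + 2 * j)"
      by (simp add: T_def norm_mult norm_power)
    also have "\<dots> \<le> (K * (q\<^sup>2) ^ k * (q\<^sup>2) ^ j) * (L * q ^ k) * r ^ (k + 2 * j)"
      using K L r q by (intro mult_mono power_mono) auto
    also have "r ^ (k + 2 * j) = r ^ k * (r\<^sup>2) ^ j" by (simp only: power_add power_mult)
    also have "(K * (q\<^sup>2) ^ k * (q\<^sup>2) ^ j) * (L * q ^ k) * (r ^ k * (r\<^sup>2) ^ j) = (K * L) * ((q\<^sup>2 * q) * r) ^ k * (q\<^sup>2 * r\<^sup>2) ^ j"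
      by (simp only: power_mult_distrib power_add power_mult mult_ac)
    also have "q\<^sup>2 * q = q ^ 3" by (simp add: power_numeral_reduce)
    finally show ?thesis .
  qed
  have "q\<^sup>2 * r\<^sup>2 < 1"
  proof -
    have "q\<^sup>2 * r\<^sup>2 \<le> q ^ 4 * r\<^sup>2" using q r by (intro mult_right_mono power_increasing) auto
    with q3 show ?thesis by simp
  qed
  then obtain S where S: "(\<lambda>k. \<Sum>j. T k j) sums S" "(\<lambda>N. \<Sum>j\<le>N div 2. T (N - 2 * j) j) sums S"
    by (elim sums_rearrange[of 2 T, OF _ bound, rotated 4]) (use q3 q r in auto)
  have "(\<Sum>j\<le>N div 2. T (N - 2 * j) j) = hahn_gen_coeff \<alpha> \<beta> t N * \<rho> ^ N" for N
  proof -
    have "(\<Sum>j\<le>N div 2. T (N - 2 * j) j) = (\<Sum>j\<le>N div 2.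
        of_real (pochhammer (\<beta> - 1 / 2) (N - j) / pochhammer (\<gamma> + 1 / 2) (N - j) *
          (pochhammer (\<beta> - \<gamma>) j / fact j) * gegenbauer_weight (\<gamma> - 1 / 2) (N - 2 * j)) * F (N - 2 * j)) * \<rho> ^ N"
      unfolding sum_distrib_right
    proof (intro sum.cong refl)
      fix j assume "j \<in> {..N div 2}"
      then have "N - 2 * j + j = N - j" "N - 2 * j + 2 * j = N" by auto
      then show "T (N - 2 * j) j = of_real (pochhammer (\<beta> - 1 / 2) (N - j) / pochhammer (\<gamma> + 1 / 2) (N - j) *
          (pochhammer (\<beta> - \<gamma>) j / fact j) * gegenbauer_weight (\<gamma> - 1 / 2) (N - 2 * j)) * F (N - 2 * j) * \<rho> ^ N"
        unfolding T_def connection_term_def by (simp only:)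
    qed
    then show ?thesis
      unfolding F_def hahn_connection[OF pos(3,2)] hahn_gen_coeff_def .
  qed
  with S(2) have "(\<lambda>N. hahn_gen_coeff \<alpha> \<beta> t N * \<rho> ^ N) sums S" by simp
  with hahn_generating_function[OF pos(1,2) assms(1), of t]
  have S_eq: "S = (1 - \<rho>) powr of_real (1 - 2 * \<beta>) *
     hypergeo [of_real (\<beta> - 1 / 2), of_real \<beta>, t] [of_real \<alpha>, of_real \<beta>] (- (4 * \<rho>) / (1 - \<rho>)\<^sup>2)"
    using sums_unique2 by blast
  have term_eq: "(\<Sum>j. T k j) = complex_of_real
            (pochhammer (2 * \<beta> - 1) (2 * k) / (pochhammer \<alpha> k * pochhammer \<beta> k * pochhammer (2 * \<gamma> + real k - 1) k)) *
          hypergeo [of_real (\<beta> + real k - 1 / 2), of_real (\<beta> - \<gamma>)] [of_real (\<gamma> + real k + 1 / 2)] (\<rho>\<^sup>2) *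
          (- \<i> * \<rho>) ^ k * (\<i> ^ k * of_real (pochhammer \<alpha> k * pochhammer \<gamma> k / fact k) * F k)" for k
  proof -
    define w where "w = pochhammer (\<beta> - 1 / 2) k / pochhammer (\<gamma> + 1 / 2) k * gegenbauer_weight (\<gamma> - 1 / 2) k"
    define u where "u = (\<lambda>j. pochhammer (\<beta> + real k - 1 / 2) j / pochhammer (\<gamma> + real k + 1 / 2) j *
        (pochhammer (\<beta> - \<gamma>) j / fact j))"
    have "norm (\<rho>\<^sup>2) < 1" using assms(1) by (simp add: norm_power power_less_one_iff)
    then have "(\<lambda>j. of_real (u j) * (\<rho>\<^sup>2) ^ j) sums
        hypergeo [of_real (\<beta> + real k - 1 / 2), of_real (\<beta> - \<gamma>)] [of_real (\<gamma> + real k + 1 / 2)] (\<rho>\<^sup>2)"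
      unfolding u_def using pos by (intro hypergeo_2_1_sums) auto
    then have "(\<lambda>j. of_real w * F k * \<rho> ^ k * (of_real (u j) * (\<rho>\<^sup>2) ^ j)) sums (of_real w * F k * \<rho> ^ k *
        hypergeo [of_real (\<beta> + real k - 1 / 2), of_real (\<beta> - \<gamma>)] [of_real (\<gamma> + real k + 1 / 2)] (\<rho>\<^sup>2))"
      by (rule sums_mult)
    moreover have "T k j = of_real w * F k * \<rho> ^ k * (of_real (u j) * (\<rho>\<^sup>2) ^ j)" for j
    proof -
      \<comment> \<open>Splitting (z)_(k+j) = (z)_k (z + k)_j separates the factor depending on k
        from the 2F1 coefficients.\<close>
      have "connection_term \<beta> \<gamma> k j = w * u j"
        unfolding connection_term_def w_def u_def pochhammer_product' by (simp add: algebra_simps)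
      then show ?thesis by (simp add: T_def power_add power_mult)
    qed
    ultimately have sum: "(\<Sum>j. T k j) = of_real w * F k * \<rho> ^ k *
        hypergeo [of_real (\<beta> + real k - 1 / 2), of_real (\<beta> - \<gamma>)] [of_real (\<gamma> + real k + 1 / 2)] (\<rho>\<^sup>2)"
      by (simp add: sums_iff)
    have "pochhammer \<alpha> k \<noteq> 0" using pos by (intro pochhammer_real_nonzero)
    then have w: "w = pochhammer (2 * \<beta> - 1) (2 * k) / (pochhammer \<alpha> k * pochhammer \<beta> k * pochhammer (2 * \<gamma> + real k - 1) k) *
        (pochhammer \<alpha> k * pochhammer \<gamma> k / fact k)"
      unfolding w_def gegenbauer_weight_expand[OF pos(3,2), symmetric] by simp
    \<comment> \<open>The powers of i in the theorem and in p_k cancel.\<close>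
    have \<rho>: "\<rho> ^ k = (- \<i> * \<rho>) ^ k * \<i> ^ k"
      unfolding power_mult_distrib[symmetric] by (simp add: mult.assoc mult.commute[of \<rho>])
    show ?thesis
      unfolding sum w \<rho> of_real_mult[of "_ / _"] by (simp only: mult_ac)
  qed
  have "Im a = Im c" using assms by simp
  note hahn = cont_hahn_eq_hahn_sum[OF assms(2,4) this]
  have eqs: "\<alpha> + 2 * Re b - 1 = 2 * \<beta> - 1" "\<alpha> + 2 * Re c = 2 * \<gamma>" "Re b - Re c = \<beta> - \<gamma>"
    "1 - \<alpha> - 2 * Re b = 1 - 2 * \<beta>"
    by (simp_all add: \<alpha>_def \<beta>_def \<gamma>_def)
  show ?thesis
    using S(1) unfolding S_eq term_eq hahn ab eqs \<alpha>_def[symmetric] \<beta>_def[symmetric] \<gamma>_def[symmetric] t_def[symmetric]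
      F_def[symmetric] .
qed

end
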